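(* Let $G$ be a finitely generated group with non-empty contracting boundary. Then $\partial_c^{\mathcal{FQ}}G$ is second countable.
   Context: A function $\rho\colon[0,\infty)\to\mathbb{R}$ is sublinear if it is non-decreasing, eventually non-negative, and $\lim_{r\to\infty}\rho(r)/r=0$. Let $X$ be a proper geodesic metric space with metric $d$. For a closed subset $Z\subset X$ let $\pi_Z(x):=\{z\in Z\mid d(x,z)=d(x,Z)\}$. For sublinear $\rho$, $Z$ is $\rho$-contracting if for all $x,y\in X$: $d(x,y)\le d(x,Z)$ implies $\operatorname{diam}(\pi_Z(x)\cup\pi_Z(y))\le\rho(d(x,Z))$. $Z$ is contracting if it is $\rho$-contracting for some sublinear $\rho$. A geodesic is an isometric embedding of an interval. For $L\ge1$, $A\ge0$, an $(L,A)$-quasi-geodesic is a map $\gamma$ from an interval with $\frac1L|s-t|-A\le d(\gamma(s),\gamma(t))\le L|s-t|+A$ for all $s,t$; a ray has domain $[0,\infty)$. Quasi-geodesics are conflated with their images, and a quasi-geodesic is contracting if its image is. Fix a basepoint $o\in X$. $\partial_cX$ is the set of contracting quasi-geodesic rays based at $o$ modulo finite Hausdorff distance. Every $\zeta\in\partial_cX$ contains a geodesic ray based at $o$; the function $\rho_\zeta(r):=\sup\operatorname{diam}(\pi_\alpha(x)\cup\pi_\alpha(y))$, with supremum over geodesic rays $\alpha\in\zeta$ (based at $o$) and points $x,y$ with $d(x,y)\le d(x,\alpha)\le r$, is sublinear and every geodesic in $\zeta$ is $\rho_\zeta$-contracting. For each $\zeta$ fix a geodesic ray $\alpha^\zeta\in\zeta$.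 For sublinear $\rho$, $L\ge1$, $A\ge0$ set $\kappa(\rho,L,A):=\max\{3A,\,3L^2,\,1+\inf\{R>0\mid\forall r\ge R,\ 3L^2\rho(r)\le r\}\}$. For $r\ge1$, $U(\zeta,r)$ is the set of $\eta\in\partial_cX$ such that for all $L\ge1$, $A\ge0$ and every continuous $(L,A)$-quasi-geodesic ray $\beta\in\eta$ (based at $o$) we have $d(\beta,\{x\in\alpha^\zeta\mid d(x,o)\ge r\})\le\kappa(\rho_\zeta,L,A)$. The topology of fellow-travelling quasi-geodesics is $\mathcal{FQ}:=\{U\subset\partial_cX\mid\forall\zeta\in U\ \exists r\ge1,\ U(\zeta,r)\subset U\}$, and $\partial_c^{\mathcal{FQ}}X$ is $\partial_cX$ with this topology. For a finitely generated group $G$, $\partial_c^{\mathcal{FQ}}G$ means $\partial_c^{\mathcal{FQ}}X$ for $X$ the Cayley graph of $G$ with respect to a fixed finite generating set, with basepoint the identity vertex. *)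

theory Defs
  imports "HOL-Analysis.Analysis" "HOL-Algebra.Generated_Groups"
begin

section \<open>Metric graphs and Cayley graphs\<close>

text \<open>
  A simple graph is given by its vertex set \<open>V\<close> and its adjacency relation \<open>E\<close>. A point of its
  geometric realization is encoded by its barycentric coordinates, a function on vertices.
\<close>

definition vertex_point :: "'v \<Rightarrow> 'v \<Rightarrow> real" where
  "vertex_point u = (\<lambda>w. if w = u then 1 else 0)"

definition edge_point :: "'v \<Rightarrow> 'v \<Rightarrow> real \<Rightarrow> 'v \<Rightarrow> real" where
  "edge_point u v t = (\<lambda>w. (1 - t) * vertex_point u w + t * vertex_point v w)"

definition graph_points :: "'v set \<Rightarrow> ('v \<Rightarrow> 'v \<Rightarrow> bool) \<Rightarrow> ('v \<Rightarrow> real) set" where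
  "graph_points V E = vertex_point ` V \<union> {edge_point u v t | u v t. E u v \<and> 0 \<le> t \<and> t \<le> 1}"

text \<open>
  \<open>graph_path V E x l y\<close>: some concatenation of finitely many segments, each inside one closed
  edge, leads from \<open>x\<close> to \<open>y\<close> and has total length \<open>l\<close>; every edge has length 1.
\<close>

inductive graph_path :: "'v set \<Rightarrow> ('v \<Rightarrow> 'v \<Rightarrow> bool) \<Rightarrow> ('v \<Rightarrow> real) \<Rightarrow> real \<Rightarrow> ('v \<Rightarrow> real) \<Rightarrow> bool"
  for V :: "'v set" and E :: "'v \<Rightarrow> 'v \<Rightarrow> bool" where
  refl: "x \<in> graph_points V E \<Longrightarrow> graph_path V E x 0 x"
| step: "\<lbrakk>E u v; 0 \<le> s; s \<le> 1; 0 \<le> t; t \<le> 1; graph_path V E (edge_point u v t) l y\<rbrakk>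
    \<Longrightarrow> graph_path V E (edge_point u v s) (\<bar>s - t\<bar> + l) y"

text \<open>
  Outside the realization the distance is set to 0 because \<open>Metric_space\<close> demands nonnegativity and
  symmetry of a metric on the whole ambient type.
\<close>

definition graph_dist :: "'v set \<Rightarrow> ('v \<Rightarrow> 'v \<Rightarrow> bool) \<Rightarrow> ('v \<Rightarrow> real) \<Rightarrow> ('v \<Rightarrow> real) \<Rightarrow> real" where
  "graph_dist V E x y =
     (if x \<in> graph_points V E \<and> y \<in> graph_points V E then Inf {l. graph_path V E x l y} else 0)"

text \<open>The Cayley graph is taken as an undirected simple graph: no loop for \<open>\<one> \<in> S\<close>, one edge for an
  involution or for a pair of mutually inverse generators.\<close>

definition cayley_adj :: "('a, 'b) monoid_scheme \<Rightarrow> 'a set \<Rightarrow> 'a \<Rightarrow> 'a \<Rightarrow> bool" where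
  "cayley_adj G S g h \<longleftrightarrow> g \<in> carrier G \<and> h \<in> carrier G \<and> g \<noteq> h \<and>
     (inv\<^bsub>G\<^esub> g \<otimes>\<^bsub>G\<^esub> h \<in> S \<or> inv\<^bsub>G\<^esub> h \<otimes>\<^bsub>G\<^esub> g \<in> S)"

definition cayley_graph :: "('a, 'b) monoid_scheme \<Rightarrow> 'a set \<Rightarrow> ('a \<Rightarrow> real) metric" where
  "cayley_graph G S =
     metric (graph_points (carrier G) (cayley_adj G S), graph_dist (carrier G) (cayley_adj G S))"

text \<open>
  The type \<open>'a metric\<close> only carries the intended points and distance if these satisfy the metric
  axioms. The following facts establish this when \<open>S\<close> generates \<open>G\<close>.
\<close>

lemma edge_point_0 [simp]: "edge_point u v 0 = vertex_point u"
  and edge_point_1 [simp]: "edge_point u v 1 = vertex_point v"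
  by (auto simp: edge_point_def)

lemma graph_path_nonneg: "graph_path V E x l y \<Longrightarrow> 0 \<le> l"
  by (induction rule: graph_path.induct) auto

lemma graph_path_points: "graph_path V E x l y \<Longrightarrow> x \<in> graph_points V E \<and> y \<in> graph_points V E"
  by (induction rule: graph_path.induct) (auto simp: graph_points_def)

lemma graph_path_trans:
  "\<lbrakk>graph_path V E x l y; graph_path V E y m z\<rbrakk> \<Longrightarrow> graph_path V E x (l + m) z"
  by (induction rule: graph_path.induct) (auto simp: add.assoc intro: graph_path.step)

lemma graph_path_segment:
  assumes "E u v" "0 \<le> s" "s \<le> 1" "0 \<le> t" "t \<le> 1"
  shows "graph_path V E (edge_point u v s) \<bar>s - t\<bar> (edge_point u v t)"
proof -
  have "edge_point u v t \<in> graph_points V E"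
    using assms by (auto simp: graph_points_def)
  then show ?thesis
    using graph_path.step[of E u v s t V 0 "edge_point u v t"] graph_path.refl assms by fastforce
qed

lemma graph_path_sym: "graph_path V E x l y \<Longrightarrow> graph_path V E y l x"
proof (induction rule: graph_path.induct)
  case (step u v s t l y)
  have "graph_path V E (edge_point u v t) \<bar>t - s\<bar> (edge_point u v s)"
    using step by (intro graph_path_segment) auto
  with step.IH have "graph_path V E y (l + \<bar>t - s\<bar>) (edge_point u v s)"
    by (rule graph_path_trans)
  then show ?case
    by (simp add: abs_minus_commute add.commute)
qed (auto intro: graph_path.refl)

lemma graph_path_coord: "graph_path V E x l y \<Longrightarrow> \<bar>x w - y w\<bar> \<le> l"
proof (induction rule: graph_path.induct)
  case (step u v s t l y)
  have "edge_point u v s w - edge_point u v t w = (s - t) * (vertex_point v w - vertex_point u w)"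
    by (simp add: edge_point_def algebra_simps)
  moreover have "\<bar>vertex_point v w - vertex_point u w\<bar> \<le> 1"
    by (auto simp: vertex_point_def)
  ultimately have "\<bar>edge_point u v s w - edge_point u v t w\<bar> \<le> \<bar>s - t\<bar>"
    by (simp add: abs_mult mult_left_le)
  with step.IH show ?case by linarith
qed auto

lemma Metric_space_graph:
  assumes connected: "\<And>x y. \<lbrakk>x \<in> graph_points V E; y \<in> graph_points V E\<rbrakk> \<Longrightarrow> \<exists>l. graph_path V E x l y"
  shows "Metric_space (graph_points V E) (graph_dist V E)"
proof
  let ?P = "graph_points V E" and ?L = "\<lambda>x y. {l. graph_path V E x l y}"
  have bdd: "bdd_below (?L x y)" for x y
    by (auto intro!: bdd_belowI[of _ 0] dest: graph_path_nonneg)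
  have ne: "?L x y \<noteq> {}" if "x \<in> ?P" "y \<in> ?P" for x y
    using connected[OF that] by auto
  show "0 \<le> graph_dist V E x y" for x y
    unfolding graph_dist_def using ne by (auto intro!: cInf_greatest dest: graph_path_nonneg)
  have "?L x y = ?L y x" for x y
    by (metis graph_path_sym)
  then show "graph_dist V E x y = graph_dist V E y x" for x y
    by (simp add: graph_dist_def)
  show "graph_dist V E x y = 0 \<longleftrightarrow> x = y" if xy: "x \<in> ?P" "y \<in> ?P" for x y
  proof
    assume "graph_dist V E x y = 0"
    then have 0: "Inf (?L x y) = 0" using xy by (simp add: graph_dist_def)
    have "\<bar>x w - y w\<bar> \<le> Inf (?L x y)" for w
      using ne[OF xy] by (intro cInf_greatest) (auto dest: graph_path_coord)
    with 0 show "x = y" by (intro ext) simp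
  next
    assume "x = y"
    then have "0 \<in> ?L x y" using xy by (auto intro: graph_path.refl)
    then have "Inf (?L x y) \<le> 0" using bdd by (rule cInf_lower)
    moreover have "0 \<le> Inf (?L x y)"
      using ne[OF xy] by (intro cInf_greatest) (auto dest: graph_path_nonneg)
    ultimately show "graph_dist V E x y = 0" using xy by (simp add: graph_dist_def)
  qed
  show "graph_dist V E x z \<le> graph_dist V E x y + graph_dist V E y z"
    if xyz: "x \<in> ?P" "y \<in> ?P" "z \<in> ?P" for x y z
  proof -
    have "Inf (?L x z) \<le> l + m" if "l \<in> ?L x y" "m \<in> ?L y z" for l m
      using that graph_path_trans by (intro cInf_lower[OF _ bdd]) blast
    then have "Inf (?L x z) - m \<le> Inf (?L x y)" if "m \<in> ?L y z" for m
      using that ne[OF xyz(1,2)] by (intro cInf_greatest) (auto simp: algebra_simps)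
    then have "Inf (?L x z) - Inf (?L x y) \<le> Inf (?L y z)"
      using ne[OF xyz(2,3)] by (intro cInf_greatest) (auto simp: algebra_simps)
    then show ?thesis using xyz by (simp add: graph_dist_def)
  qed
qed

lemma Metric_space_cayley:
  fixes G (structure)
  assumes "group G" "S \<subseteq> carrier G" "generate G S = carrier G"
  shows "Metric_space (graph_points (carrier G) (cayley_adj G S)) (graph_dist (carrier G) (cayley_adj G S))"
proof (rule Metric_space_graph)
  interpret group G by fact
  let ?path = "graph_path (carrier G) (cayley_adj G S)"
  have vertex: "vertex_point g \<in> graph_points (carrier G) (cayley_adj G S)" if "g \<in> carrier G" for g
    using that by (auto simp: graph_points_def)
  have adj: "\<exists>l. ?path (vertex_point g) l (vertex_point h)"
    if "g \<in> carrier G" "h \<in> carrier G" "inv g \<otimes> h \<in> S \<or> inv h \<otimes> g \<in> S" for g h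
  proof (cases "g = h")
    case True
    then show ?thesis using graph_path.refl[OF vertex[OF that(1)]] by auto
  next
    case False
    then have "cayley_adj G S g h" using that by (auto simp: cayley_adj_def)
    then show ?thesis using graph_path_segment[of "cayley_adj G S" g h 0 1] by auto
  qed
  have carrier: "h \<in> carrier G" if "h \<in> generate G S" for h
    using that assms(3) by simp
  have path: "h \<in> generate G S \<Longrightarrow> a \<in> carrier G \<Longrightarrow> \<exists>l. ?path (vertex_point a) l (vertex_point (a \<otimes> h))" for a h
  proof (induction arbitrary: a rule: generate.induct)
    case one
    then show ?case using graph_path.refl[OF vertex] by auto
  next
    case (incl h)
    then have h: "h \<in> carrier G" "a \<in> carrier G" using assms(2) by auto
    then have "inv a \<otimes> (a \<otimes> h) = h" by (simp add: m_assoc[symmetric])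
    then show ?case using incl h by (intro adj) simp_all
  next
    case (inv h)
    then have h: "h \<in> carrier G" "a \<in> carrier G" using assms(2) by auto
    then have "inv (a \<otimes> inv h) \<otimes> a = h" by (simp add: inv_mult_group m_assoc)
    then show ?case using inv h by (intro adj) simp_all
  next
    case (eng h1 h2)
    have h: "h1 \<in> carrier G" "h2 \<in> carrier G" using eng.hyps by (auto intro: carrier)
    then have ah: "a \<otimes> h1 \<in> carrier G" using eng.prems by simp
    from eng.IH(1)[OF eng.prems] obtain l where "?path (vertex_point a) l (vertex_point (a \<otimes> h1))" ..
    moreover from eng.IH(2)[OF ah] obtain m
      where "?path (vertex_point (a \<otimes> h1)) m (vertex_point (a \<otimes> h1 \<otimes> h2))" ..
    ultimately have "?path (vertex_point a) (l + m) (vertex_point (a \<otimes> h1 \<otimes> h2))"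
      by (rule graph_path_trans)
    then show ?case using eng.prems h by (auto simp: m_assoc)
  qed
  have conn: "\<exists>l. ?path (vertex_point a) l (vertex_point b)" if "a \<in> carrier G" "b \<in> carrier G" for a b
  proof -
    have "a \<otimes> (inv a \<otimes> b) = b" using that by (simp add: m_assoc[symmetric])
    then show ?thesis using path[of "inv a \<otimes> b" a] that assms(3) by auto
  qed
  have to_vertex: "\<exists>l. \<exists>a\<in>carrier G. ?path x l (vertex_point a)"
    if "x \<in> graph_points (carrier G) (cayley_adj G S)" for x
  proof -
    from that consider a where "a \<in> carrier G" "x = vertex_point a"
      | u v t where "cayley_adj G S u v" "0 \<le> t" "t \<le> 1" "x = edge_point u v t"
      by (auto simp: graph_points_def)
    then show ?thesis
    proof cases
      case 1
      then show ?thesis using graph_path.refl[OF vertex] by blast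
    next
      case 2
      then have "u \<in> carrier G" by (auto simp: cayley_adj_def)
      then show ?thesis using graph_path_segment[of "cayley_adj G S" u v t 0] 2 by auto
    qed
  qed
  fix x y
  assume "x \<in> graph_points (carrier G) (cayley_adj G S)" "y \<in> graph_points (carrier G) (cayley_adj G S)"
  then obtain l a m b where "a \<in> carrier G" "?path x l (vertex_point a)"
    "b \<in> carrier G" "?path y m (vertex_point b)"
    by (meson to_vertex)
  moreover from this obtain k where "?path (vertex_point a) k (vertex_point b)"
    using conn by blast
  ultimately show "\<exists>l. ?path x l y"
    by (blast intro: graph_path_trans graph_path_sym[of _ _ y])
qed

lemma
  assumes "group G" "S \<subseteq> carrier G" "generate G S = carrier G"
  shows mspace_cayley_graph: "mspace (cayley_graph G S) = graph_points (carrier G) (cayley_adj G S)"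
    and mdist_cayley_graph: "mdist (cayley_graph G S) = graph_dist (carrier G) (cayley_adj G S)"
  using Metric_space_cayley[OF assms]
  by (simp_all add: cayley_graph_def Metric_space.mspace_metric Metric_space.mdist_metric)


section \<open>Contracting sets\<close>

definition set_dist :: "'a metric \<Rightarrow> 'a set \<Rightarrow> 'a set \<Rightarrow> real" where
  "set_dist X A B = Inf {mdist X a b | a b. a \<in> A \<and> b \<in> B}"

abbreviation point_dist :: "'a metric \<Rightarrow> 'a \<Rightarrow> 'a set \<Rightarrow> real" where
  "point_dist X x Z \<equiv> set_dist X {x} Z"

definition diam :: "'a metric \<Rightarrow> 'a set \<Rightarrow> real" where
  "diam X A = (if A = {} then 0 else Sup {mdist X a b | a b. a \<in> A \<and> b \<in> A})"

definition proj :: "'a metric \<Rightarrow> 'a set \<Rightarrow> 'a \<Rightarrow> 'a set" where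
  "proj X Z x = {z \<in> Z. mdist X x z = point_dist X x Z}"

text \<open>A function on \<open>[0,\<infinity>)\<close> is represented by a function on the reals whose values at negative
  arguments are ignored.\<close>

definition sublinear :: "(real \<Rightarrow> real) \<Rightarrow> bool" where
  "sublinear \<rho> \<longleftrightarrow> mono_on {0..} \<rho> \<and> (\<forall>\<^sub>F r in at_top. 0 \<le> \<rho> r) \<and> ((\<lambda>r. \<rho> r / r) \<longlongrightarrow> 0) at_top"

text \<open>Closedness is part of the notion: the closest point projection to a nonclosed set may be empty,
  and the diameter condition would then hold vacuously.\<close>

definition rho_contracting :: "'a metric \<Rightarrow> (real \<Rightarrow> real) \<Rightarrow> 'a set \<Rightarrow> bool" where
  "rho_contracting X \<rho> Z \<longleftrightarrow>
     closedin (mtopology_of X) Z \<and>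
     (\<forall>x \<in> mspace X. \<forall>y \<in> mspace X. mdist X x y \<le> point_dist X x Z \<longrightarrow>
        diam X (proj X Z x \<union> proj X Z y) \<le> \<rho> (point_dist X x Z))"

definition contracting :: "'a metric \<Rightarrow> 'a set \<Rightarrow> bool" where
  "contracting X Z \<longleftrightarrow> (\<exists>\<rho>. sublinear \<rho> \<and> rho_contracting X \<rho> Z)"


section \<open>Rays\<close>

text \<open>A ray is an extensional function on \<open>[0,\<infinity>)\<close>, so that equality of rays is equality of maps with
  domain \<open>[0,\<infinity>)\<close>.\<close>

definition quasi_geodesic_ray :: "'a metric \<Rightarrow> real \<Rightarrow> real \<Rightarrow> (real \<Rightarrow> 'a) \<Rightarrow> bool" where
  "quasi_geodesic_ray X L A \<gamma> \<longleftrightarrow>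
     \<gamma> \<in> {0..} \<rightarrow>\<^sub>E mspace X \<and>
     (\<forall>s\<ge>0. \<forall>t\<ge>0. \<bar>s - t\<bar> / L - A \<le> mdist X (\<gamma> s) (\<gamma> t) \<and> mdist X (\<gamma> s) (\<gamma> t) \<le> L * \<bar>s - t\<bar> + A)"

definition geodesic_ray :: "'a metric \<Rightarrow> (real \<Rightarrow> 'a) \<Rightarrow> bool" where
  "geodesic_ray X \<gamma> \<longleftrightarrow>
     \<gamma> \<in> {0..} \<rightarrow>\<^sub>E mspace X \<and> (\<forall>s\<ge>0. \<forall>t\<ge>0. mdist X (\<gamma> s) (\<gamma> t) = \<bar>s - t\<bar>)"

definition continuous_ray :: "'a metric \<Rightarrow> (real \<Rightarrow> 'a) \<Rightarrow> bool" where
  "continuous_ray X \<gamma> \<longleftrightarrow> continuous_map (top_of_set {0..}) (mtopology_of X) \<gamma>"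

abbreviation ray_image :: "(real \<Rightarrow> 'a) \<Rightarrow> 'a set" where
  "ray_image \<gamma> \<equiv> \<gamma> ` {0..}"


section \<open>The contracting boundary\<close>

text \<open>From here on \<open>p\<close> is the basepoint.\<close>

definition contracting_rays :: "'a metric \<Rightarrow> 'a \<Rightarrow> (real \<Rightarrow> 'a) set" where
  "contracting_rays X p =
     {\<gamma>. (\<exists>L\<ge>1. \<exists>A\<ge>0. quasi_geodesic_ray X L A \<gamma>) \<and> \<gamma> 0 = p \<and> contracting X (ray_image \<gamma>)}"

definition finite_hausdorff_dist :: "'a metric \<Rightarrow> 'a set \<Rightarrow> 'a set \<Rightarrow> bool" where
  "finite_hausdorff_dist X A B \<longleftrightarrow>
     (\<exists>C. (\<forall>a\<in>A. \<exists>b\<in>B. mdist X a b \<le> C) \<and> (\<forall>b\<in>B. \<exists>a\<in>A. mdist X a b \<le> C))"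

definition contracting_boundary :: "'a metric \<Rightarrow> 'a \<Rightarrow> (real \<Rightarrow> 'a) set set" where
  "contracting_boundary X p =
     contracting_rays X p //
       {(\<beta>, \<gamma>) \<in> contracting_rays X p \<times> contracting_rays X p.
          finite_hausdorff_dist X (ray_image \<beta>) (ray_image \<gamma>)}"

text \<open>The supremum below is over a set of numbers contained in \<open>[0,4r]\<close>: points of the two
  projections are within \<open>r\<close> of \<open>x\<close> and within \<open>2r\<close> of \<open>y\<close>, respectively.\<close>

definition rho_of :: "'a metric \<Rightarrow> (real \<Rightarrow> 'a) set \<Rightarrow> real \<Rightarrow> real" where
  "rho_of X \<zeta> r =
     Sup {diam X (proj X (ray_image \<alpha>) x \<union> proj X (ray_image \<alpha>) y) | \<alpha> x y.
            \<alpha> \<in> \<zeta> \<and> geodesic_ray X \<alpha> \<and> x \<in> mspace X \<and> y \<in> mspace X \<and>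
            mdist X x y \<le> point_dist X x (ray_image \<alpha>) \<and> point_dist X x (ray_image \<alpha>) \<le> r}"

definition kappa :: "(real \<Rightarrow> real) \<Rightarrow> real \<Rightarrow> real \<Rightarrow> real" where
  "kappa \<rho> L A =
     Max {3 * A, 3 * L\<^sup>2, 1 + Inf {R. R > 0 \<and> (\<forall>r\<ge>R. 3 * L\<^sup>2 * \<rho> r \<le> r)}}"


section \<open>The topology of fellow-travelling quasi-geodesics\<close>

text \<open>The function \<open>\<alpha>\<close> assigns to each boundary point its fixed geodesic representative.\<close>

definition geodesic_choice ::
    "'a metric \<Rightarrow> 'a \<Rightarrow> ((real \<Rightarrow> 'a) set \<Rightarrow> real \<Rightarrow> 'a) \<Rightarrow> bool" where
  "geodesic_choice X p \<alpha> \<longleftrightarrow>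
     (\<forall>\<zeta> \<in> contracting_boundary X p. \<alpha> \<zeta> \<in> \<zeta> \<and> geodesic_ray X (\<alpha> \<zeta>))"

definition fq_nbhd ::
    "'a metric \<Rightarrow> 'a \<Rightarrow> ((real \<Rightarrow> 'a) set \<Rightarrow> real \<Rightarrow> 'a) \<Rightarrow> (real \<Rightarrow> 'a) set \<Rightarrow> real \<Rightarrow>
     (real \<Rightarrow> 'a) set set" where
  "fq_nbhd X p \<alpha> \<zeta> r =
     {\<eta> \<in> contracting_boundary X p.
        \<forall>L\<ge>1. \<forall>A\<ge>0. \<forall>\<beta>\<in>\<eta>. continuous_ray X \<beta> \<and> quasi_geodesic_ray X L A \<beta> \<longrightarrow>
          set_dist X (ray_image \<beta>) {x \<in> ray_image (\<alpha> \<zeta>). mdist X x p \<ge> r}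
            \<le> kappa (rho_of X \<zeta>) L A}"

definition fq_open ::
    "'a metric \<Rightarrow> 'a \<Rightarrow> ((real \<Rightarrow> 'a) set \<Rightarrow> real \<Rightarrow> 'a) \<Rightarrow> (real \<Rightarrow> 'a) set set \<Rightarrow> bool" where
  "fq_open X p \<alpha> U \<longleftrightarrow>
     U \<subseteq> contracting_boundary X p \<and> (\<forall>\<zeta>\<in>U. \<exists>r\<ge>1. fq_nbhd X p \<alpha> \<zeta> r \<subseteq> U)"

definition fq_topology ::
    "'a metric \<Rightarrow> 'a \<Rightarrow> ((real \<Rightarrow> 'a) set \<Rightarrow> real \<Rightarrow> 'a) \<Rightarrow> (real \<Rightarrow> 'a) set topology" where
  "fq_topology X p \<alpha> = topology (fq_open X p \<alpha>)"

text \<open>The sets \<open>fq_open\<close> do form a topology, because \<open>fq_nbhd\<close> is antimonotone in \<open>r\<close>.\<close>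

lemma boundary_point_ray:
  assumes "\<eta> \<in> contracting_boundary X p" "\<beta> \<in> \<eta>"
  shows "\<beta> \<in> contracting_rays X p"
  using assms by (auto simp: contracting_boundary_def quotient_def)

lemma fq_nbhd_antimono:
  assumes \<alpha>: "geodesic_choice X p \<alpha>" and \<zeta>: "\<zeta> \<in> contracting_boundary X p" and r: "0 \<le> r" "r \<le> r'"
  shows "fq_nbhd X p \<alpha> \<zeta> r' \<subseteq> fq_nbhd X p \<alpha> \<zeta> r"
proof -
  let ?Z = "\<lambda>r. {x \<in> ray_image (\<alpha> \<zeta>). mdist X x p \<ge> r}"
  have geo: "geodesic_ray X (\<alpha> \<zeta>)" and "\<alpha> \<zeta> 0 = p"
    using \<alpha> \<zeta> boundary_point_ray[OF \<zeta>] by (auto simp: geodesic_choice_def contracting_rays_def)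
  then have "mdist X (\<alpha> \<zeta> r') p = r'"
    using r unfolding geodesic_ray_def by (metis abs_of_nonneg diff_zero dual_order.trans order_refl)
  then have ne: "\<alpha> \<zeta> r' \<in> ?Z r'" using r by auto
  have "set_dist X (ray_image \<beta>) (?Z r) \<le> set_dist X (ray_image \<beta>) (?Z r')" for \<beta>
    unfolding set_dist_def
  proof (rule cInf_superset_mono)
    show "{mdist X a b |a b. a \<in> ray_image \<beta> \<and> b \<in> ?Z r'} \<noteq> {}" using ne by auto
    show "bdd_below {mdist X a b |a b. a \<in> ray_image \<beta> \<and> b \<in> ?Z r}"
      by (rule bdd_belowI[of _ 0]) auto
    have "?Z r' \<subseteq> ?Z r" using r by auto
    then show "{mdist X a b |a b. a \<in> ray_image \<beta> \<and> b \<in> ?Z r'} \<subseteq> {mdist X a b |a b. a \<in> ray_image \<beta> \<and> b \<in> ?Z r}"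
      by blast
  qed
  then show ?thesis unfolding fq_nbhd_def by (blast intro: order_trans)
qed

lemma openin_fq_topology:
  assumes "geodesic_choice X p \<alpha>"
  shows "openin (fq_topology X p \<alpha>) U \<longleftrightarrow> fq_open X p \<alpha> U"
proof -
  have "istopology (fq_open X p \<alpha>)"
    unfolding istopology_def
  proof (intro conjI allI impI)
    fix S T assume S: "fq_open X p \<alpha> S" and T: "fq_open X p \<alpha> T"
    show "fq_open X p \<alpha> (S \<inter> T)"
      unfolding fq_open_def
    proof (intro conjI ballI)
      show "S \<inter> T \<subseteq> contracting_boundary X p" using S by (auto simp: fq_open_def)
      fix \<zeta> assume "\<zeta> \<in> S \<inter> T"
      with S T obtain r r' where r: "1 \<le> r" "1 \<le> r'" "fq_nbhd X p \<alpha> \<zeta> r \<subseteq> S" "fq_nbhd X p \<alpha> \<zeta> r' \<subseteq> T"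
        and \<zeta>: "\<zeta> \<in> contracting_boundary X p"
        unfolding fq_open_def by blast
      have "fq_nbhd X p \<alpha> \<zeta> (max r r') \<subseteq> S \<inter> T"
        using r fq_nbhd_antimono[OF assms \<zeta>, of r "max r r'"] fq_nbhd_antimono[OF assms \<zeta>, of r' "max r r'"]
        by (metis (no_types, lifting) le_infI max.cobounded1 max.cobounded2 order_trans zero_le_one)
      then show "\<exists>r\<ge>1. fq_nbhd X p \<alpha> \<zeta> r \<subseteq> S \<inter> T" using r by (intro exI[of _ "max r r'"]) auto
    qed
  next
    fix K assume K: "\<forall>S\<in>K. fq_open X p \<alpha> S"
    show "fq_open X p \<alpha> (\<Union>K)"
      unfolding fq_open_def
    proof (intro conjI ballI)
      show "\<Union>K \<subseteq> contracting_boundary X p" using K by (auto simp: fq_open_def)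
      fix \<zeta> assume "\<zeta> \<in> \<Union>K"
      then obtain S where S: "S \<in> K" "\<zeta> \<in> S" by blast
      with K obtain r where "1 \<le> r" "fq_nbhd X p \<alpha> \<zeta> r \<subseteq> S" unfolding fq_open_def by blast
      with S show "\<exists>r\<ge>1. fq_nbhd X p \<alpha> \<zeta> r \<subseteq> \<Union>K" by (intro exI[of _ r]) auto
    qed
  qed
  then show ?thesis by (simp add: fq_topology_def)
qed

end

theory Submission
  imports Defs "HOL-Real_Asymp.Real_Asymp"
begin

text \<open>
  The group is used only through the countability of the vertices of its Cayley graph; the argument
  works in every length space \<open>X\<close> with a countable coarsely dense subset. No countable family
  of sublinear functions is cofinal, but membership of \<open>\<eta>\<close> in \<open>U(\<zeta>, r)\<close> only concerns constants with \<open>\<kappa>(\<rho>\<^sub>\<zeta>, L, A) < r\<close>, hence \<open>L, A \<le> r\<close>. Let \<open>N(q, n, C)\<close> be the set of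
  those \<open>\<eta>\<close> for which every continuous \<open>(n, n)\<close>-quasi-geodesic in \<open>\<eta>\<close> passes within \<open>C\<close> of \<open>q\<close>.
  If \<open>q\<close> lies far out on \<open>\<alpha>\<^sup>\<zeta>\<close>, contraction gives \<open>U(\<zeta>, R) \<subseteq> N(q, n, C) \<subseteq> U(\<zeta>, n)\<close> for large \<open>R\<close>,
  and for \<open>q\<close>, \<open>n\<close>, \<open>C\<close> countably many choices suffice.

  The interiors of the sets \<open>N(q, n, C)\<close> form the base. They are computed by the implication from
  \<open>\<eta> \<in> N(q, 5 n + 5, C)\<close> to \<open>U(\<eta>, r) \<subseteq> N(q, n, C)\<close> for some \<open>r\<close>: a quasi-geodesic \<open>\<beta>\<close> coming
  near \<open>\<alpha>\<^sup>\<eta>\<close> far away from the basepoint is redirected there to follow \<open>\<alpha>\<^sup>\<eta>\<close>, which yields an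
  element of \<open>\<eta>\<close> with constants depending on \<open>n\<close> only, and it agrees with \<open>\<beta>\<close> near \<open>q\<close>.
\<close>


section \<open>Contracting projections and quasi-geodesics\<close>

text \<open>Attained distances are part of the notion. For images of continuous quasi-geodesic rays
  they come from compactness of time intervals, in \<open>cqg_ray_proximinal\<close>.\<close>

definition proximinal :: "'a metric \<Rightarrow> 'a set \<Rightarrow> bool" where
  "proximinal X Z \<longleftrightarrow> Z \<subseteq> mspace X \<and> (\<forall>x\<in>mspace X. proj X Z x \<noteq> {})"

text \<open>Pointwise form of contraction, free of suprema. For proximinal sets it follows from
  \<open>rho_contracting\<close> with the same function and gives it back with twice that
  function.\<close>

definition proj_bound :: "'a metric \<Rightarrow> (real \<Rightarrow> real) \<Rightarrow> 'a set \<Rightarrow> bool" where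
  "proj_bound X \<rho> Z \<longleftrightarrow> (\<forall>x\<in>mspace X. \<forall>y\<in>mspace X. mdist X x y \<le> point_dist X x Z \<longrightarrow>
     (\<forall>p\<in>proj X Z x. \<forall>q\<in>proj X Z y. mdist X p q \<le> \<rho> (point_dist X x Z)))"

definition cqg_ray :: "'a metric \<Rightarrow> real \<Rightarrow> real \<Rightarrow> (real \<Rightarrow> 'a) \<Rightarrow> bool" where
  "cqg_ray X L A \<beta> \<longleftrightarrow> continuous_ray X \<beta> \<and> quasi_geodesic_ray X L A \<beta>"

text \<open>The three requirements behind the maximum in \<open>kappa\<close>. Unlike the value of
  \<open>kappa\<close>, they survive enlarging \<open>K\<close>.\<close>

definition qg_threshold :: "(real \<Rightarrow> real) \<Rightarrow> real \<Rightarrow> real \<Rightarrow> real \<Rightarrow> bool" where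
  "qg_threshold \<rho> L A K \<longleftrightarrow> 3 * A \<le> K \<and> 3 * L\<^sup>2 \<le> K \<and> (\<forall>r\<ge>K. 3 * L\<^sup>2 * \<rho> r \<le> r)"

lemma proximinalD: "proximinal X Z \<Longrightarrow> z \<in> Z \<Longrightarrow> z \<in> mspace X"
  by (auto simp: proximinal_def)

lemma proximinal_projE:
  assumes "proximinal X Z" "x \<in> mspace X"
  obtains z where "z \<in> proj X Z x"
  using assms by (auto simp: proximinal_def)

lemma projD: "z \<in> proj X Z x \<Longrightarrow> z \<in> Z \<and> mdist X x z = point_dist X x Z"
  by (simp add: proj_def)

lemma set_dist_le:
  assumes "a \<in> A" "b \<in> B"
  shows "set_dist X A B \<le> mdist X a b"
  unfolding set_dist_def
  by (rule cInf_lower) (use assms in \<open>auto intro!: bdd_belowI[of _ 0]\<close>)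

lemma point_dist_le: "z \<in> Z \<Longrightarrow> point_dist X x Z \<le> mdist X x z"
  by (rule set_dist_le) auto

lemma point_dist_nonneg:
  assumes "proximinal X Z" "x \<in> mspace X"
  shows "0 \<le> point_dist X x Z"
  using assms by (metis mdist_nonneg proximinal_projE projD)

lemma point_dist_triangle:
  assumes "proximinal X Z" "x \<in> mspace X" "y \<in> mspace X"
  shows "point_dist X x Z \<le> mdist X x y + point_dist X y Z"
proof -
  obtain z where z: "z \<in> proj X Z y" using assms proximinal_projE by metis
  then have "z \<in> mspace X" using assms(1) by (meson projD proximinalD)
  then have "mdist X x z \<le> mdist X x y + mdist X y z" using assms mdist_triangle by metis
  then show ?thesis using z point_dist_le[of z Z X x] projD[OF z] by linarith
qed

lemma point_dist_Lipschitz: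
  assumes "proximinal X Z" "x \<in> mspace X" "y \<in> mspace X"
  shows "\<bar>point_dist X x Z - point_dist X y Z\<bar> \<le> mdist X x y"
  using point_dist_triangle[OF assms] point_dist_triangle[OF assms(1,3,2)]
  by (simp add: mdist_commute)

lemma proximinal_closedin:
  assumes Z: "proximinal X Z"
  shows "closedin (mtopology_of X) Z"
proof -
  interpret Metric_space "mspace X" "mdist X" by simp
  have "closedin mtopology Z"
    unfolding closedin_metric
  proof (intro conjI ballI allI impI)
    show "Z \<subseteq> mspace X" using Z by (simp add: proximinal_def)
    fix x assume "x \<in> mspace X - Z"
    then have x: "x \<in> mspace X" "x \<notin> Z" by auto
    obtain z where z: "z \<in> proj X Z x" using Z x proximinal_projE by metis
    then have "z \<in> Z" "z \<noteq> x" using x projD by metis+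
    then have "0 < mdist X x z" using x proximinalD[OF Z] by (simp add: order_less_le)
    moreover have "mdist X x z \<le> mdist X x w" if "w \<in> Z" for w
      using point_dist_le[OF that] projD[OF z] by metis
    ultimately show "\<exists>r>0. disjnt Z (mball x r)"
      by (intro exI[of _ "mdist X x z"]) (auto simp: disjnt_iff not_less)
  qed
  then show ?thesis by (simp add: mtopology_of_def)
qed

lemma cqg_rayD:
  assumes "cqg_ray X L A \<beta>" "0 \<le> s" "0 \<le> t"
  shows "\<beta> s \<in> mspace X" "\<bar>s - t\<bar> / L - A \<le> mdist X (\<beta> s) (\<beta> t)"
    "mdist X (\<beta> s) (\<beta> t) \<le> L * \<bar>s - t\<bar> + A"
  using assms by (auto simp: cqg_ray_def quasi_geodesic_ray_def PiE_iff)

lemma continuous_ray_iff: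
  assumes \<beta>: "\<beta> \<in> {0..} \<rightarrow> mspace X"
  shows "continuous_ray X \<beta> \<longleftrightarrow>
    (\<forall>t\<ge>0. \<forall>e>0. \<exists>d>0. \<forall>s\<ge>0. \<bar>s - t\<bar> < d \<longrightarrow> mdist X (\<beta> s) (\<beta> t) < e)" (is "_ \<longleftrightarrow> ?R")
proof
  interpret Metric_space "mspace X" "mdist X" by simp
  have *: "continuous_ray X \<beta> \<longleftrightarrow> (\<forall>t\<ge>0. \<forall>e>0. \<exists>U. openin (top_of_set {0..}) U \<and> t \<in> U \<and> (\<forall>y\<in>U. \<beta> y \<in> mball (\<beta> t) e))"
    unfolding continuous_ray_def mtopology_of_def by (simp add: continuous_map_to_metric Ball_def)
  show ?R if "continuous_ray X \<beta>"
  proof (intro allI impI)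
    fix t e :: real assume t: "0 \<le> t" "0 < e"
    with that * obtain U where U: "openin (top_of_set {0..}) U" "t \<in> U" "\<forall>y\<in>U. \<beta> y \<in> mball (\<beta> t) e" by blast
    then obtain d where "0 < d" "\<forall>s\<in>{0..}. dist s t < d \<longrightarrow> s \<in> U"
      unfolding openin_euclidean_subtopology_iff by blast
    moreover from this U(3) have "mdist X (\<beta> s) (\<beta> t) < e" if "0 \<le> s" "\<bar>s - t\<bar> < d" for s
      using that by (simp add: dist_real_def mdist_commute)
    ultimately show "\<exists>d>0. \<forall>s\<ge>0. \<bar>s - t\<bar> < d \<longrightarrow> mdist X (\<beta> s) (\<beta> t) < e"
      by blast
  qed
  show "continuous_ray X \<beta>" if R: ?R
    unfolding *
  proof (intro allI impI)
    fix t e :: real assume t: "0 \<le> t" "0 < e"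
    with R obtain d where d: "0 < d" "\<forall>s\<ge>0. \<bar>s - t\<bar> < d \<longrightarrow> mdist X (\<beta> s) (\<beta> t) < e" by blast
    have "openin (top_of_set {0..}) ({0..} \<inter> ball t d)" by (simp add: openin_open_Int)
    moreover have "\<forall>y\<in>{0..} \<inter> ball t d. \<beta> y \<in> mball (\<beta> t) e"
      using d(2) \<beta> t by (auto simp: dist_real_def mdist_commute abs_minus_commute Pi_iff)
    ultimately show "\<exists>U. openin (top_of_set {0..}) U \<and> t \<in> U \<and> (\<forall>y\<in>U. \<beta> y \<in> mball (\<beta> t) e)"
      using d t by (intro exI[of _ "{0..} \<inter> ball t d"]) auto
  qed
qed

lemma continuous_on_along_ray:
  fixes f :: "'a \<Rightarrow> real"
  assumes \<beta>: "cqg_ray X L A \<beta>"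
    and f: "\<And>x y. x \<in> mspace X \<Longrightarrow> y \<in> mspace X \<Longrightarrow> \<bar>f x - f y\<bar> \<le> mdist X x y"
  shows "continuous_on {0..} (\<lambda>t. f (\<beta> t))"
  unfolding continuous_on_iff
proof (intro ballI allI impI)
  fix t e :: real assume t: "t \<in> {0..}" "0 < e"
  have "\<beta> \<in> {0..} \<rightarrow> mspace X" using cqg_rayD(1)[OF \<beta>] by auto
  with \<beta> t obtain d where d: "0 < d" "\<forall>s\<ge>0. \<bar>s - t\<bar> < d \<longrightarrow> mdist X (\<beta> s) (\<beta> t) < e"
    unfolding cqg_ray_def using continuous_ray_iff by (metis atLeast_iff)
  have "dist (f (\<beta> s)) (f (\<beta> t)) < e" if "s \<in> {0..}" "dist s t < d" for s
    using d(2) f[of "\<beta> s" "\<beta> t"] cqg_rayD(1)[OF \<beta>] t that by (simp add: dist_real_def) (meson le_less_trans)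
  with d(1) show "\<exists>d>0. \<forall>s\<in>{0..}. dist s t < d \<longrightarrow> dist (f (\<beta> s)) (f (\<beta> t)) < e"
    by blast
qed

lemma mdist_Lipschitz:
  assumes "z \<in> mspace X" "x \<in> mspace X" "y \<in> mspace X"
  shows "\<bar>mdist X z x - mdist X z y\<bar> \<le> mdist X x y"
  using mdist_triangle[OF assms] mdist_triangle[of z X y x] assms by (simp add: mdist_commute)

text \<open>By the triangle inequality and the lower quasi-geodesic bound, after time
  \<open>T\<close> the ray is at least as far from \<open>x\<close> as \<open>\<beta> 0\<close> is,
  so a minimum over the compact interval \<open>{0..T}\<close> is a minimum over the whole
  ray.\<close>

lemma cqg_ray_proximinal:
  assumes \<beta>: "cqg_ray X L A \<beta>" and L: "1 \<le> L"
  shows "proximinal X (ray_image \<beta>)"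
  unfolding proximinal_def
proof (intro conjI ballI)
  show "ray_image \<beta> \<subseteq> mspace X" using cqg_rayD(1)[OF \<beta>] by auto
  fix x assume x: "x \<in> mspace X"
  let ?f = "\<lambda>t. mdist X x (\<beta> t)"
  define T where "T = max 0 (L * (2 * ?f 0 + A))"
  have "continuous_on {0..} ?f"
    by (rule continuous_on_along_ray[OF \<beta>]) (rule mdist_Lipschitz[OF x])
  then have "continuous_on {0..T} ?f" by (rule continuous_on_subset) auto
  moreover have "0 \<le> T" by (simp add: T_def)
  ultimately obtain m where m: "m \<in> {0..T}" "\<And>t. t \<in> {0..T} \<Longrightarrow> ?f m \<le> ?f t"
    using continuous_attains_inf[of "{0..T}" ?f] by fastforce
  have "?f m \<le> ?f t" if t: "0 \<le> t" for t
  proof (cases "t \<le> T")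
    case False
    then have "L * (2 * ?f 0 + A) \<le> t" by (simp add: T_def)
    then have "2 * ?f 0 + A \<le> t / L" using L by (simp add: field_simps)
    moreover have "t / L - A \<le> mdist X (\<beta> 0) (\<beta> t)" using cqg_rayD(2)[OF \<beta>, of 0 t] t by simp
    moreover have "mdist X (\<beta> 0) (\<beta> t) \<le> ?f 0 + ?f t"
      using mdist_triangle[of "\<beta> 0" X x "\<beta> t"] x cqg_rayD(1)[OF \<beta>] t by (simp add: mdist_commute)
    ultimately have "?f 0 \<le> ?f t" by linarith
    moreover have "?f m \<le> ?f 0" using m \<open>0 \<le> T\<close> by simp
    ultimately show ?thesis by linarith
  qed (use m t in auto)
  then have "point_dist X x (ray_image \<beta>) = ?f m"
    unfolding set_dist_def using m by (intro cInf_eq_minimum) auto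
  then show "proj X (ray_image \<beta>) x \<noteq> {}" using m by (auto simp: proj_def)
qed

text \<open>The largest element of the compact level set of \<open>K\<close> works: a later value
  below \<open>K\<close> would force another crossing by the intermediate value theorem.\<close>

lemma last_exit:
  fixes f :: "real \<Rightarrow> real"
  assumes "continuous_on {u..v} f" "u \<le> v" "f u \<le> K" "K \<le> f v"
  obtains a where "u \<le> a" "a \<le> v" "f a = K" "\<And>t. a \<le> t \<Longrightarrow> t \<le> v \<Longrightarrow> K \<le> f t"
proof -
  let ?S = "{t\<in>{u..v}. f t = K}"
  have "closed ?S" using continuous_closed_preimage_constant[OF assms(1)] by simp
  then have c: "compact ?S"
    by (rule compact_eq_bounded_closed[THEN iffD2, OF conjI, rotated]) (rule bounded_subset[of "{u..v}"], auto)
  have ne: "?S \<noteq> {}" using IVT'[of f u K v] assms by auto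
  obtain a where a: "a \<in> ?S" "\<And>t. t \<in> ?S \<Longrightarrow> t \<le> a" using compact_attains_sup[OF c ne] by blast
  have "K \<le> f t" if t: "a \<le> t" "t \<le> v" for t
  proof (rule ccontr)
    assume less: "\<not> K \<le> f t"
    have "continuous_on {t..v} f" using assms(1) by (rule continuous_on_subset) (use a t in auto)
    with less obtain s where s: "t \<le> s" "s \<le> v" "f s = K" using IVT'[of f t K v] assms(4) t by auto
    then have "s \<le> a" using a(1) t by (intro a(2)) auto
    then have "s = t" using s t by linarith
    with s less show False by simp
  qed
  then show ?thesis using that a by auto
qed

text \<open>Time reversal of \<open>last_exit\<close>.\<close>

lemma first_entry:
  fixes f :: "real \<Rightarrow> real"
  assumes "continuous_on {u..v} f" "u \<le> v" "K \<le> f u" "f v \<le> K"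
  obtains b where "u \<le> b" "b \<le> v" "f b = K" "\<And>t. u \<le> t \<Longrightarrow> t \<le> b \<Longrightarrow> K \<le> f t"
proof -
  let ?g = "\<lambda>t. f (u + v - t)"
  have "continuous_on {u..v} ?g"
    by (rule continuous_on_compose2[OF assms(1)]) (auto intro!: continuous_intros)
  then obtain a where a: "u \<le> a" "a \<le> v" "?g a = K" "\<And>t. a \<le> t \<Longrightarrow> t \<le> v \<Longrightarrow> K \<le> ?g t"
    using last_exit[of u v ?g K] assms by auto
  have "K \<le> f t" if "u \<le> t" "t \<le> u + v - a" for t using a(4)[of "u + v - t"] that by simp
  with a that[of "u + v - a"] show ?thesis by auto
qed

section \<open>Excursions of quasi-geodesics away from a contracting set\<close>

lemma qg_thresholdD:
  assumes "qg_threshold \<rho> L A K" "1 \<le> L" "K \<le> r"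
  shows "3 * A \<le> r" "3 * L\<^sup>2 \<le> r" "3 \<le> r" "\<rho> r \<le> r / (3 * L\<^sup>2)"
proof -
  show "3 * A \<le> r" "3 * L\<^sup>2 \<le> r" using assms by (auto simp: qg_threshold_def)
  moreover have "1 \<le> L\<^sup>2" using assms by simp
  ultimately show "3 \<le> r" by linarith
  show "\<rho> r \<le> r / (3 * L\<^sup>2)" using assms by (auto simp: qg_threshold_def field_simps)
qed

lemma qg_image_diam:
  assumes Z: "proximinal X Z" and \<rho>: "proj_bound X \<rho> Z"
    and \<beta>: "cqg_ray X L A \<beta>" and L: "1 \<le> L" and K: "qg_threshold \<rho> L A K"
    and "0 \<le> a" "a \<le> b" "\<And>t. a \<le> t \<Longrightarrow> t \<le> b \<Longrightarrow> K \<le> point_dist X (\<beta> t) Z"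
    and "p \<in> proj X Z (\<beta> a)" and q: "q \<in> proj X Z (\<beta> b)"
  shows "mdist X p q \<le> 4 / 5 * ((b - a) / L) + 4 / 3 * point_dist X (\<beta> b) Z"
proof -
  let ?d = "\<lambda>t. point_dist X (\<beta> t) Z"
  \<comment> \<open>Jump from \<open>a\<close> to a time \<open>t\<close> with \<open>d(\<beta> a, \<beta> t) = d(\<beta> a, Z)\<close>: the projection moves by at most
    \<open>\<rho> (d(\<beta> a, Z)) \<le> (t - a) / (2 L)\<close>, and \<open>t - a \<ge> 2\<close>, so finitely many jumps exhaust \<open>[a, b]\<close>. If no
    such \<open>t\<close> exists, one application of the projection bound suffices.\<close>
  obtain n :: nat where "b - a \<le> n" using real_arch_simple by blast
  then show ?thesis using assms(6-9)
  proof (induction n arbitrary: a p rule: less_induct)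
    case (less n)
    have M: "\<beta> t \<in> mspace X" if "0 \<le> t" for t using cqg_rayD(1)[OF \<beta>] that by auto
    note a = less.prems
    have Ka: "K \<le> ?d a" and Kb: "K \<le> ?d b" using a by auto
    note da = qg_thresholdD[OF K L Ka] and db = qg_thresholdD[OF K L Kb]
    have L0: "0 < L" "0 < L\<^sup>2" using L by auto
    have p: "p \<in> Z" "q \<in> Z" "p \<in> mspace X" "q \<in> mspace X"
      using projD[OF a(5)] projD[OF q] proximinalD[OF Z] by auto
    show ?case
    proof (cases "\<exists>t\<in>{a..b}. mdist X (\<beta> a) (\<beta> t) = ?d a")
      case True
      then obtain t where t: "a \<le> t" "t \<le> b" "mdist X (\<beta> a) (\<beta> t) = ?d a" by auto
      have t0: "0 \<le> t" using t a by linarith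
      obtain p' where p': "p' \<in> proj X Z (\<beta> t)" using proximinal_projE[OF Z M[OF t0]] .
      have p'Z: "p' \<in> mspace X" using projD[OF p'] proximinalD[OF Z] by blast
      have "mdist X p p' \<le> \<rho> (?d a)"
        using \<rho> M[OF a(2)] M[OF t0] t(3) a(5) p' unfolding proj_bound_def by simp
      then have 1: "mdist X p p' \<le> ?d a / (3 * L\<^sup>2)" using da by linarith
      have "?d a \<le> L * (t - a) + A" using cqg_rayD(3)[OF \<beta>, of a t] t a by simp
      \<comment> \<open>The threshold gives \<open>3 * A \<le> ?d a\<close>, so the additive
        constant costs at most a third of \<open>?d a\<close>.\<close>
      then have 2: "2 / 3 * ?d a \<le> L * (t - a)" using da by linarith
      then have "2 / 3 * (3 * L\<^sup>2) \<le> L * (t - a)" using da by linarith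
      then have "L * (2 * L) \<le> L * (t - a)" by (simp add: power2_eq_square)
      then have "2 * L \<le> t - a" using L0 by simp
      then have *: "2 \<le> t - a" using L by linarith
      then have "2 \<le> b - a" using t by linarith
      then have "1 \<le> n" using a(1) by linarith
      have "b - t \<le> real (n - 1)" using * a(1) \<open>1 \<le> n\<close> by (simp add: of_nat_diff)
      then have IH: "mdist X p' q \<le> 4 / 5 * ((b - t) / L) + 4 / 3 * ?d b"
        using less.IH[of "n - 1" t p'] \<open>1 \<le> n\<close> a t p' by auto
      have "?d a / (3 * L\<^sup>2) = (2 / 3 * ?d a) / (2 * L\<^sup>2)" by simp
      also have "\<dots> \<le> (L * (t - a)) / (2 * L\<^sup>2)" using 2 L0 by (intro divide_right_mono) auto
      also have "\<dots> = 1 / 2 * ((t - a) / L)" using L0 by (simp add: power2_eq_square)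
      also have "\<dots> \<le> 4 / 5 * ((t - a) / L)" using L0 t by (intro mult_right_mono) auto
      finally have "mdist X p p' \<le> 4 / 5 * ((t - a) / L)" using 1 by linarith
      moreover have "mdist X p q \<le> mdist X p p' + mdist X p' q" using p p'Z mdist_triangle by metis
      moreover have "(b - a) / L = (t - a) / L + (b - t) / L" by (simp add: diff_divide_distrib)
      ultimately show ?thesis using IH by linarith
    next
      case False
      have cont: "continuous_on {a..b} (\<lambda>t. mdist X (\<beta> a) (\<beta> t))"
        by (rule continuous_on_subset[OF continuous_on_along_ray[OF \<beta> mdist_Lipschitz[OF M[OF a(2)]]]])
          (use a(2) in auto)
      have near: "mdist X (\<beta> a) (\<beta> b) \<le> ?d a"
      proof (rule ccontr)
        assume "\<not> ?thesis"
        moreover have "mdist X (\<beta> a) (\<beta> a) = 0" using M a by simp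
        moreover have "0 \<le> ?d a" using da by linarith
        ultimately obtain t where "a \<le> t" "t \<le> b" "mdist X (\<beta> a) (\<beta> t) = ?d a"
          using IVT'[of "\<lambda>t. mdist X (\<beta> a) (\<beta> t)" a "?d a" b] cont a(3) by auto
        with False show False by auto
      qed
      have b0: "0 \<le> b" using a by linarith
      have "mdist X p q \<le> \<rho> (?d a)"
        using \<rho> M[OF a(2)] M[OF b0] near a(5) q unfolding proj_bound_def by simp
      then have 1: "mdist X p q \<le> ?d a / (3 * L\<^sup>2)" using da by linarith
      have ge: "0 \<le> 4 / 5 * ((b - a) / L)" using L0 a by auto
      \<comment> \<open>The last jump is charged to \<open>?d b\<close> if that is comparable to
        \<open>?d a\<close>, and to time otherwise: with \<open>A \<le> ?d a / 3\<close> and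
        \<open>?d b < ?d a / 4\<close> there remains \<open>1 - 1/3 - 1/4 = 5/12\<close> of
        \<open>?d a\<close>, and division by \<open>3 * L\<^sup>2\<close> produces the rate
        \<open>4 / 5\<close> of the statement.\<close>
      show ?thesis
      proof (cases "?d a \<le> 4 * ?d b")
        case True
        have "?d a / (3 * L\<^sup>2) \<le> ?d a / 3"
          using L da(3) by (intro divide_left_mono) auto
        then show ?thesis using 1 True ge by linarith
      next
        case far: False
        have "?d a \<le> mdist X (\<beta> a) (\<beta> b) + ?d b"
          by (rule point_dist_triangle[OF Z M[OF a(2)] M[OF b0]])
        moreover have "mdist X (\<beta> a) (\<beta> b) \<le> L * (b - a) + A"
          using cqg_rayD(3)[OF \<beta>, of a b] a by simp
        ultimately have "5 / 12 * ?d a \<le> L * (b - a)" using da far by linarith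
        then have "?d a / (3 * L\<^sup>2) \<le> (12 / 5 * (L * (b - a))) / (3 * L\<^sup>2)"
          using L0 by (intro divide_right_mono) auto
        also have "\<dots> = 4 / 5 * ((b - a) / L)" using L0 by (simp add: power2_eq_square divide_simps)
        finally show ?thesis using 1 db(3) by linarith
      qed
    qed
  qed
qed

text \<open>Going from \<open>\<beta> a\<close> to \<open>\<beta> b\<close> through their
  projections bounds the distance from above, where the projections move apart at rate
  \<open>4 / 5\<close> of \<open>(b - a) / L\<close> by \<open>qg_image_diam\<close>. Since
  \<open>4 / 5 < 1\<close>, the lower bound \<open>(b - a) / L - A\<close> absorbs that
  term.\<close>

lemma qg_excursion_length:
  assumes Z: "proximinal X Z" and \<rho>: "proj_bound X \<rho> Z"
    and \<beta>: "cqg_ray X L A \<beta>" and L: "1 \<le> L" and K: "qg_threshold \<rho> L A K"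
    and ab: "0 \<le> a" "a \<le> b" "\<And>t. a \<le> t \<Longrightarrow> t \<le> b \<Longrightarrow> K \<le> point_dist X (\<beta> t) Z"
  shows "b - a \<le> 5 * L * (A + point_dist X (\<beta> a) Z + 3 * point_dist X (\<beta> b) Z)"
proof -
  let ?d = "\<lambda>t. point_dist X (\<beta> t) Z"
  have M: "\<beta> a \<in> mspace X" "\<beta> b \<in> mspace X" using cqg_rayD(1)[OF \<beta>] ab by auto
  obtain p q where pq: "p \<in> proj X Z (\<beta> a)" "q \<in> proj X Z (\<beta> b)"
    using proximinal_projE[OF Z M(1)] proximinal_projE[OF Z M(2)] by metis
  have pqM: "p \<in> mspace X" "q \<in> mspace X"
    using proximinalD[OF Z] projD[OF pq(1)] projD[OF pq(2)] by blast+
  have "(b - a) / L - A \<le> mdist X (\<beta> a) (\<beta> b)" using cqg_rayD(2)[OF \<beta>, of a b] ab by simp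
  also have "\<dots> \<le> mdist X (\<beta> a) p + mdist X p (\<beta> b)" using M pqM by (intro mdist_triangle)
  also have "mdist X p (\<beta> b) \<le> mdist X p q + mdist X q (\<beta> b)" using M pqM by (intro mdist_triangle)
  finally have "(b - a) / L - A \<le> ?d a + mdist X p q + ?d b"
    using projD[OF pq(1)] projD[OF pq(2)] by (simp add: mdist_commute)
  moreover have "mdist X p q \<le> 4 / 5 * ((b - a) / L) + 4 / 3 * ?d b"
    using qg_image_diam[OF Z \<rho> \<beta> L K ab pq] .
  moreover have "0 \<le> ?d b" using point_dist_nonneg[OF Z M(2)] .
  \<comment> \<open>With \<open>(b - a) / L\<close> opaque the rest is linear: solving for
    \<open>x\<close> gives the coefficient \<open>5 * 7 / 3\<close> at \<open>v\<close>, rounded up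
    to 15.\<close>
  moreover define x where "x = (b - a) / L"
  moreover have "x \<le> 5 * (A + u + 3 * v)" if "x - A \<le> u + m + v" "m \<le> 4 / 5 * x + 4 / 3 * v" "0 \<le> v" for u v m
    using that by (simp add: algebra_simps)
  ultimately have "x \<le> 5 * (A + ?d a + 3 * ?d b)" unfolding x_def[symmetric] by blast
  then show ?thesis using L by (simp add: x_def pos_divide_le_eq mult_ac)
qed

lemma continuous_point_dist:
  assumes "proximinal X Z" "cqg_ray X L A \<beta>" "0 \<le> u"
  shows "continuous_on {u..v} (\<lambda>t. point_dist X (\<beta> t) Z)"
  by (rule continuous_on_subset[OF continuous_on_along_ray[OF assms(2) point_dist_Lipschitz[OF assms(1)]]])
    (use assms(3) in auto)

text \<open>A point beyond \<open>K\<close> lies in an excursion from a last exit \<open>a\<close>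
  to a first entry \<open>b\<close>, both at distance exactly \<open>K\<close>. Its duration is
  bounded by \<open>qg_excursion_length\<close>, and the upper quasi-geodesic bound turns elapsed
  time into distance.\<close>

lemma qg_excursion_bound:
  assumes Z: "proximinal X Z" and \<rho>: "proj_bound X \<rho> Z"
    and \<beta>: "cqg_ray X L A \<beta>" and L: "1 \<le> L" and K: "qg_threshold \<rho> L A K" and A: "0 \<le> A"
    and st: "0 \<le> s" "s \<le> u" "u \<le> t" "point_dist X (\<beta> s) Z \<le> K" "point_dist X (\<beta> t) Z \<le> K"
  shows "point_dist X (\<beta> u) Z \<le> K + A + 5 * L\<^sup>2 * (A + 4 * K)"
proof (cases "point_dist X (\<beta> u) Z \<le> K")
  let ?d = "\<lambda>t. point_dist X (\<beta> t) Z"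
  case True
  moreover have "0 \<le> K" using qg_thresholdD(3)[OF K L order_refl] by simp
  moreover have "0 \<le> 5 * L\<^sup>2 * (A + 4 * K)" using A \<open>0 \<le> K\<close> by simp
  ultimately show ?thesis using A by linarith
next
  let ?d = "\<lambda>t. point_dist X (\<beta> t) Z"
  case False
  obtain a where a: "s \<le> a" "a \<le> u" "?d a = K" "\<And>t. a \<le> t \<Longrightarrow> t \<le> u \<Longrightarrow> K \<le> ?d t"
    using last_exit[OF continuous_point_dist[OF Z \<beta> st(1), of u] st(2,4)] False by auto
  have u0: "0 \<le> u" using st by simp
  obtain b where b: "u \<le> b" "b \<le> t" "?d b = K" "\<And>t. u \<le> t \<Longrightarrow> t \<le> b \<Longrightarrow> K \<le> ?d t"
    using first_entry[OF continuous_point_dist[OF Z \<beta> u0, of t] st(3) _ st(5)] False by auto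
  have a0: "0 \<le> a" using a st by simp
  have "b - a \<le> 5 * L * (A + ?d a + 3 * ?d b)"
  proof (rule qg_excursion_length[OF Z \<rho> \<beta> L K a0])
    show "a \<le> b" using a b by simp
    show "K \<le> ?d t" if "a \<le> t" "t \<le> b" for t using a(4)[of t] b(4)[of t] that by linarith
  qed
  then have "b - a \<le> 5 * L * (A + K + 3 * K)" unfolding a(3) b(3) .
  also have "A + K + 3 * K = A + 4 * K" by simp
  finally have len: "u - a \<le> 5 * L * (A + 4 * K)" using b(1) by linarith
  have "?d u \<le> mdist X (\<beta> u) (\<beta> a) + ?d a"
    using point_dist_triangle[OF Z] cqg_rayD(1)[OF \<beta>] a0 u0 by auto
  also have "mdist X (\<beta> u) (\<beta> a) \<le> L * (u - a) + A"
    using cqg_rayD(3)[OF \<beta>, of u a] a0 u0 a by simp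
  also have "L * (u - a) \<le> L * (5 * L * (A + 4 * K))" using len L by (intro mult_left_mono) auto
  finally show ?thesis using a by (simp add: power2_eq_square mult_ac)
qed

text \<open>Even if \<open>D\<close> is much larger than \<open>K\<close>, the ray cannot stay
  beyond \<open>K\<close> forever, because excursions ending within \<open>D\<close> have bounded
  duration. This replaces an uncontrolled distance by a constant depending on \<open>\<rho>\<close>,
  \<open>L\<close> and \<open>A\<close> only.\<close>

lemma qg_returns:
  assumes Z: "proximinal X Z" and \<rho>: "proj_bound X \<rho> Z"
    and \<beta>: "cqg_ray X L A \<beta>" and L: "1 \<le> L" and K: "qg_threshold \<rho> L A K" and A: "0 \<le> A"
    and near: "\<And>t. 0 \<le> t \<Longrightarrow> point_dist X (\<beta> t) Z \<le> D" and start: "\<beta> 0 \<in> Z"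
  obtains t where "T \<le> t" "0 \<le> t" "point_dist X (\<beta> t) Z \<le> K"
proof (rule ccontr)
  let ?d = "\<lambda>t. point_dist X (\<beta> t) Z"
  assume "\<not> thesis"
  then have far: "K < ?d t" if "T \<le> t" "0 \<le> t" for t
    using that \<open>\<And>t. \<lbrakk>T \<le> t; 0 \<le> t; ?d t \<le> K\<rbrakk> \<Longrightarrow> thesis\<close> by (meson not_le)
  have K0: "3 \<le> K" using qg_thresholdD[OF K L order_refl] by simp
  have M: "\<beta> t \<in> mspace X" if "0 \<le> t" for t using cqg_rayD(1)[OF \<beta>] that by auto
  have "point_dist X (\<beta> 0) Z \<le> mdist X (\<beta> 0) (\<beta> 0)" using start by (rule point_dist_le)
  moreover have "mdist X (\<beta> 0) (\<beta> 0) = 0" using M[of 0] by simp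
  ultimately have d0: "?d 0 \<le> K" using K0 by simp
  have D0: "0 \<le> D" using near[of 0] point_dist_nonneg[OF Z M[of 0]] by simp
  \<comment> \<open>\<open>b\<close> comes after \<open>T\<close> by more than the maximal duration
    of an excursion ending within \<open>D\<close>, so the last exit before \<open>b\<close> also
    happens after \<open>T\<close>.\<close>
  define b where "b = max T 0 + 5 * L * (A + K + 3 * D) + 1"
  have "0 \<le> 5 * L * (A + K + 3 * D)" using L K0 A D0 by simp
  then have b: "0 \<le> b" "T \<le> b" by (auto simp: b_def)
  obtain a where a: "0 \<le> a" "a \<le> b" "?d a = K" "\<And>t. a \<le> t \<Longrightarrow> t \<le> b \<Longrightarrow> K \<le> ?d t"
    using last_exit[OF continuous_point_dist[OF Z \<beta> order_refl, of b] b(1) d0] far[of b] b by auto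
  have "b - a \<le> 5 * L * (A + ?d a + 3 * ?d b)"
    by (rule qg_excursion_length[OF Z \<rho> \<beta> L K a(1,2,4)])
  also have "\<dots> \<le> 5 * L * (A + K + 3 * D)" using L near[OF b(1)] a(3) by (intro mult_left_mono) auto
  finally have "max T 0 + 1 \<le> a" by (simp add: b_def)
  then have "T \<le> a" by linarith
  then show False using far[of a] a by simp
qed

section \<open>Quasi-geodesics along a contracting geodesic ray\<close>

lemma geodesic_ray_cqg:
  assumes "geodesic_ray X \<gamma>"
  shows "cqg_ray X 1 0 \<gamma>"
proof -
  have \<gamma>: "\<gamma> \<in> {0..} \<rightarrow> mspace X" "\<forall>s\<ge>0. \<forall>t\<ge>0. mdist X (\<gamma> s) (\<gamma> t) = \<bar>s - t\<bar>"
    using assms by (auto simp: geodesic_ray_def PiE_iff)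
  have "continuous_ray X \<gamma>"
    unfolding continuous_ray_iff[OF \<gamma>(1)] using \<gamma>(2) by auto
  then show ?thesis using assms \<gamma>(2)
    by (auto simp: cqg_ray_def quasi_geodesic_ray_def geodesic_ray_def)
qed

lemma geodesic_ray_proximinal: "geodesic_ray X \<gamma> \<Longrightarrow> proximinal X (ray_image \<gamma>)"
  using cqg_ray_proximinal[OF geodesic_ray_cqg] by auto

text \<open>The intermediate value theorem gives a time \<open>u\<close> on the sphere of radius
  \<open>R\<close> about \<open>\<gamma> 0\<close>. The nearest point \<open>\<gamma> s\<close> to
  \<open>\<beta> u\<close> is within the excursion bound, so \<open>s\<close> differs from
  \<open>R\<close> by at most that bound; this is the factor 2.\<close>

lemma qg_tracks_geodesic:
  assumes \<gamma>: "geodesic_ray X \<gamma>" and \<rho>: "proj_bound X \<rho> (ray_image \<gamma>)"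
    and \<beta>: "cqg_ray X L A \<beta>" and L: "1 \<le> L" and K: "qg_threshold \<rho> L A K" and A: "0 \<le> A"
    and start: "\<beta> 0 = \<gamma> 0"
    and t: "0 \<le> t" "point_dist X (\<beta> t) (ray_image \<gamma>) \<le> K"
    and R: "0 \<le> R" "R \<le> mdist X (\<gamma> 0) (\<beta> t)"
  obtains u where "0 \<le> u" "u \<le> t" "mdist X (\<beta> u) (\<gamma> R) \<le> 2 * (K + A + 5 * L\<^sup>2 * (A + 4 * K))"
proof -
  let ?Z = "ray_image \<gamma>"
  have Z: "proximinal X ?Z" using geodesic_ray_proximinal[OF \<gamma>] .
  have M: "\<beta> t \<in> mspace X" if "0 \<le> t" for t using cqg_rayD(1)[OF \<beta>] that by auto
  have g: "mdist X (\<gamma> s) (\<gamma> t) = \<bar>s - t\<bar>" "\<gamma> s \<in> mspace X" if "0 \<le> s" "0 \<le> t" for s t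
    using \<gamma> that by (auto simp: geodesic_ray_def PiE_iff)
  have "continuous_on {0..t} (\<lambda>t. mdist X (\<gamma> 0) (\<beta> t))"
    by (rule continuous_on_subset[OF continuous_on_along_ray[OF \<beta> mdist_Lipschitz[OF g(2)[of 0 0]]]]) auto
  moreover have "mdist X (\<gamma> 0) (\<beta> 0) = 0" using start g[of 0 0] by simp
  ultimately obtain u where u: "0 \<le> u" "u \<le> t" "mdist X (\<gamma> 0) (\<beta> u) = R"
    using IVT'[of "\<lambda>t. mdist X (\<gamma> 0) (\<beta> t)" 0 R t] R t by auto
  have "point_dist X (\<beta> 0) ?Z \<le> mdist X (\<beta> 0) (\<gamma> 0)" by (rule point_dist_le) auto
  then have "point_dist X (\<beta> 0) ?Z \<le> K"
    using start g[of 0 0] qg_thresholdD(3)[OF K L order_refl] by simp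
  then have d: "point_dist X (\<beta> u) ?Z \<le> K + A + 5 * L\<^sup>2 * (A + 4 * K)" (is "_ \<le> ?E")
    using qg_excursion_bound[OF Z \<rho> \<beta> L K A order_refl u(1,2) _ t(2)] by simp
  obtain z where "z \<in> proj X ?Z (\<beta> u)" using proximinal_projE[OF Z M[OF u(1)]] .
  then obtain s where s: "0 \<le> s" "mdist X (\<beta> u) (\<gamma> s) \<le> ?E"
    using d by (auto dest: projD)
  have "\<bar>mdist X (\<gamma> 0) (\<beta> u) - mdist X (\<gamma> 0) (\<gamma> s)\<bar> \<le> mdist X (\<beta> u) (\<gamma> s)"
    using g(2) M u s by (intro mdist_Lipschitz) auto
  then have "\<bar>R - s\<bar> \<le> ?E" using u s g(1)[of 0 s] by simp
  moreover have "mdist X (\<beta> u) (\<gamma> R) \<le> mdist X (\<beta> u) (\<gamma> s) + mdist X (\<gamma> s) (\<gamma> R)"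
    using g(2) M u s R by (intro mdist_triangle) auto
  ultimately have "mdist X (\<beta> u) (\<gamma> R) \<le> 2 * ?E" using s R g(1)[of s R] by auto
  then show ?thesis using that u by blast
qed

text \<open>Going back, if necessary, from \<open>t\<close> to the last time \<open>a\<close> within
  \<open>K\<close> of \<open>\<gamma>\<close> moves the point by an amount controlled by
  \<open>n\<close> and \<open>C\<close> alone. For \<open>R\<close> large the nearest point to
  \<open>\<beta> a\<close> is therefore still on the tail beyond \<open>r\<close>, now at distance
  \<open>K\<close> instead of \<open>C\<close>.\<close>

lemma qg_hits_tail:
  assumes \<gamma>: "geodesic_ray X \<gamma>" and \<rho>: "proj_bound X \<rho> (ray_image \<gamma>)"
    and \<beta>: "cqg_ray X L A \<beta>" and L: "1 \<le> L" and K: "qg_threshold \<rho> L A K" and A: "0 \<le> A"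
    and start: "\<beta> 0 = \<gamma> 0"
    and n: "L \<le> n" "A \<le> n" "K \<le> n"
    and t: "0 \<le> t" "mdist X (\<beta> t) (\<gamma> R) \<le> C" and R: "r + 2 * n + C + 5 * n\<^sup>2 * (2 * n + 3 * C) \<le> R" "0 \<le> R"
  shows "set_dist X (ray_image \<beta>) {x \<in> ray_image \<gamma>. r \<le> mdist X x (\<gamma> 0)} \<le> K"
proof -
  let ?Z = "ray_image \<gamma>" and ?d = "\<lambda>t. point_dist X (\<beta> t) (ray_image \<gamma>)"
  have Z: "proximinal X ?Z" using geodesic_ray_proximinal[OF \<gamma>] .
  have M: "\<beta> t \<in> mspace X" if "0 \<le> t" for t using cqg_rayD(1)[OF \<beta>] that by auto
  have g: "mdist X (\<gamma> s) (\<gamma> t) = \<bar>s - t\<bar>" "\<gamma> s \<in> mspace X" if "0 \<le> s" "0 \<le> t" for s t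
    using \<gamma> that by (auto simp: geodesic_ray_def PiE_iff)
  have K0: "3 \<le> K" using qg_thresholdD(3)[OF K L order_refl] .
  have C0: "0 \<le> C" using t(2) mdist_nonneg[of X "\<beta> t" "\<gamma> R"] by linarith
  have n0: "0 \<le> n" using L n by simp
  have "?d 0 \<le> mdist X (\<beta> 0) (\<gamma> 0)" by (rule point_dist_le) auto
  then have d0: "?d 0 \<le> K" using start g[of 0 0] K0 by simp
  have dt: "?d t \<le> C" using point_dist_le[of "\<gamma> R" ?Z X "\<beta> t"] t R(2) by auto
  obtain a where a: "0 \<le> a" "?d a \<le> K" "mdist X (\<beta> a) (\<beta> t) \<le> 5 * n\<^sup>2 * (2 * n + 3 * C) + n"
  proof (cases "?d t \<le> K")
    case True
    have "0 \<le> 5 * n\<^sup>2 * (2 * n + 3 * C) + n" using n0 C0 by simp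
    moreover have "mdist X (\<beta> t) (\<beta> t) = 0" using M[OF t(1)] by simp
    ultimately show ?thesis using that[of t] True t(1) by simp
  next
    case False
    obtain a where a: "0 \<le> a" "a \<le> t" "?d a = K" "\<And>u. a \<le> u \<Longrightarrow> u \<le> t \<Longrightarrow> K \<le> ?d u"
      using last_exit[OF continuous_point_dist[OF Z \<beta> order_refl, of t] t(1) d0] False by auto
    have "t - a \<le> 5 * L * (A + ?d a + 3 * ?d t)"
      by (rule qg_excursion_length[OF Z \<rho> \<beta> L K a(1,2,4)])
    also have "\<dots> \<le> 5 * n * (2 * n + 3 * C)"
      using n dt a(3) L A K0 C0 point_dist_nonneg[OF Z M[OF t(1)]] by (intro mult_mono) auto
    finally have "L * (t - a) \<le> n * (5 * n * (2 * n + 3 * C))" using n L a by (intro mult_mono) auto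
    moreover have "mdist X (\<beta> a) (\<beta> t) \<le> L * (t - a) + A" using cqg_rayD(3)[OF \<beta>, of a t] a t by simp
    ultimately have "mdist X (\<beta> a) (\<beta> t) \<le> n * (5 * n * (2 * n + 3 * C)) + n" using n(2) by linarith
    also have "n * (5 * n * (2 * n + 3 * C)) = 5 * n\<^sup>2 * (2 * n + 3 * C)" by (simp add: power2_eq_square)
    finally show ?thesis using that[of a] a by simp
  qed
  obtain z where "z \<in> proj X ?Z (\<beta> a)" using proximinal_projE[OF Z M[OF a(1)]] .
  then obtain s where s: "0 \<le> s" "mdist X (\<beta> a) (\<gamma> s) \<le> K"
    using a(2) by (auto dest: projD)
  have "R - s \<le> mdist X (\<gamma> s) (\<gamma> R)" using g(1) s R by auto
  also have "\<dots> \<le> mdist X (\<gamma> s) (\<beta> a) + mdist X (\<beta> a) (\<gamma> R)"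
    using g(2) M s a R by (intro mdist_triangle) auto
  also have "mdist X (\<beta> a) (\<gamma> R) \<le> mdist X (\<beta> a) (\<beta> t) + mdist X (\<beta> t) (\<gamma> R)"
    using g(2) M t a R by (intro mdist_triangle) auto
  finally have "R - s \<le> K + (5 * n\<^sup>2 * (2 * n + 3 * C) + n) + C" using s a t by (simp add: mdist_commute)
  then have "r \<le> s" using R n by linarith
  then have "set_dist X (ray_image \<beta>) {x \<in> ray_image \<gamma>. r \<le> mdist X x (\<gamma> 0)} \<le> mdist X (\<beta> a) (\<gamma> s)"
    using s a g(1)[of s 0] by (intro set_dist_le) auto
  with s show ?thesis by simp
qed

section \<open>Invariance under finite Hausdorff distance\<close>

text \<open>Almost shortest paths, parametrized as 1-Lipschitz maps: the slack \<open>e\<close>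
  matches \<open>graph_dist\<close>, which is an infimum of path lengths.\<close>

definition length_space :: "'a metric \<Rightarrow> bool" where
  "length_space X \<longleftrightarrow> (\<forall>x\<in>mspace X. \<forall>y\<in>mspace X. \<forall>e>0. \<exists>l \<sigma>. 0 \<le> l \<and> l \<le> mdist X x y + e \<and>
     \<sigma> \<in> {0..l} \<rightarrow> mspace X \<and> \<sigma> 0 = x \<and> \<sigma> l = y \<and>
     (\<forall>s\<in>{0..l}. \<forall>t\<in>{0..l}. mdist X (\<sigma> s) (\<sigma> t) \<le> \<bar>s - t\<bar>))"

lemma length_spaceE:
  assumes "length_space X" "x \<in> mspace X" "y \<in> mspace X" "0 < e"
  obtains l \<sigma> where "0 \<le> l" "l \<le> mdist X x y + e" "\<And>s. s \<in> {0..l} \<Longrightarrow> \<sigma> s \<in> mspace X"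
    "\<sigma> 0 = x" "\<sigma> l = y"
    "\<And>s t. s \<in> {0..l} \<Longrightarrow> t \<in> {0..l} \<Longrightarrow> mdist X (\<sigma> s) (\<sigma> t) \<le> \<bar>s - t\<bar>"
proof -
  from assms obtain l \<sigma> where "0 \<le> l" "l \<le> mdist X x y + e" "\<sigma> \<in> {0..l} \<rightarrow> mspace X"
    "\<sigma> 0 = x" "\<sigma> l = y" "\<forall>s\<in>{0..l}. \<forall>t\<in>{0..l}. mdist X (\<sigma> s) (\<sigma> t) \<le> \<bar>s - t\<bar>"
    unfolding length_space_def by meson
  then show ?thesis by (intro that[of l \<sigma>]) auto
qed

text \<open>The point at time \<open>min D l\<close> on a path of length at most
  \<open>mdist X x y + 1\<close>; the 1 in the conclusion is the slack of that path.\<close>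

lemma length_space_between:
  assumes "length_space X" "x \<in> mspace X" "y \<in> mspace X" "0 \<le> D" "0 \<le> C" "mdist X x y \<le> D + C"
  obtains w where "w \<in> mspace X" "mdist X x w \<le> D" "mdist X w y \<le> C + 1"
proof -
  obtain l \<sigma> where \<sigma>: "0 \<le> l" "l \<le> mdist X x y + 1" "\<And>s. s \<in> {0..l} \<Longrightarrow> \<sigma> s \<in> mspace X"
    "\<sigma> 0 = x" "\<sigma> l = y"
    "\<And>s t. s \<in> {0..l} \<Longrightarrow> t \<in> {0..l} \<Longrightarrow> mdist X (\<sigma> s) (\<sigma> t) \<le> \<bar>s - t\<bar>"
    using length_spaceE[OF assms(1-3), of 1] by auto
  show ?thesis
    using that[of "\<sigma> (min D l)"] \<sigma>(1,2,3,4,5) \<sigma>(6)[of 0 "min D l"] \<sigma>(6)[of "min D l" l] assms(4-6) by auto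
qed

text \<open>Contraction applies at \<open>y\<close> when \<open>y\<close> is at least
  \<open>C\<close> away from \<open>Z\<close>. Closer in, the route from \<open>p\<close> over
  \<open>w\<close> and \<open>y\<close> to \<open>q\<close> has length at most
  \<open>4 * C\<close>.\<close>

lemma proj_bound_near:
  assumes Z: "proximinal X Z" and \<rho>: "proj_bound X \<rho> Z" and mono: "mono_on {0..} \<rho>"
    and wy: "w \<in> mspace X" "y \<in> mspace X" "mdist X w y \<le> C" "point_dist X y Z \<le> r" "0 \<le> C"
    and pq: "p \<in> proj X Z w" "q \<in> proj X Z y"
  shows "mdist X p q \<le> max 0 (\<rho> r) + 4 * C"
proof (cases "C \<le> point_dist X y Z")
  have y0: "0 \<le> point_dist X y Z" using point_dist_nonneg[OF Z wy(2)] .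
  case True
  then have "mdist X q p \<le> \<rho> (point_dist X y Z)"
    using \<rho> wy pq unfolding proj_bound_def by (auto simp: mdist_commute[of X y w])
  also have "\<dots> \<le> \<rho> r" using mono_onD[OF mono] wy(4) y0 by simp
  finally show ?thesis using wy(5) by (simp add: mdist_commute)
next
  case False
  have M: "p \<in> mspace X" "q \<in> mspace X" using pq proximinalD[OF Z] by (auto dest: projD)
  have "mdist X p q \<le> mdist X p w + mdist X w q" using M wy by (intro mdist_triangle)
  also have "mdist X w q \<le> mdist X w y + mdist X y q" using M wy by (intro mdist_triangle)
  finally have "mdist X p q \<le> point_dist X w Z + mdist X w y + point_dist X y Z"
    using projD[OF pq(1)] projD[OF pq(2)] by (simp add: mdist_commute)
  moreover have "point_dist X w Z \<le> mdist X w y + point_dist X y Z" by (rule point_dist_triangle[OF Z wy(1,2)])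
  ultimately show ?thesis using False wy by linarith
qed

text \<open>A nearest point \<open>p'\<close> of \<open>Z'\<close> to \<open>u\<close> has within
  \<open>C + 1\<close> of it a point \<open>w\<close> with
  \<open>mdist X u w \<le> point_dist X u Z\<close>. Contraction of \<open>Z\<close> at
  \<open>u\<close> then puts the projection of \<open>w\<close>, which is close to
  \<open>p'\<close>, near the projection of \<open>u\<close>. So the projections to \<open>Z\<close>
  and \<open>Z'\<close> agree up to a value of \<open>\<rho>\<close> and a constant.\<close>

lemma proj_bound_hausdorff:
  assumes X: "length_space X" and Z: "proximinal X Z" and \<rho>: "proj_bound X \<rho> Z" and mono: "mono_on {0..} \<rho>"
    and Z': "Z' \<subseteq> mspace X" and C: "0 \<le> C"
    and close: "\<And>z. z \<in> Z' \<Longrightarrow> point_dist X z Z \<le> C" "\<And>z. z \<in> Z \<Longrightarrow> \<exists>z'\<in>Z'. mdist X z z' \<le> C"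
  shows "proj_bound X (\<lambda>r. 4 * max 0 (\<rho> (2 * r + 3 * C)) + (16 * C + 12)) Z'"
  unfolding proj_bound_def
proof (intro ballI impI)
  fix x y p' q'
  assume x: "x \<in> mspace X" and y: "y \<in> mspace X" and xy: "mdist X x y \<le> point_dist X x Z'"
    and p': "p' \<in> proj X Z' x" and q': "q' \<in> proj X Z' y"
  let ?d = "\<lambda>x. point_dist X x Z" and ?d' = "\<lambda>x. point_dist X x Z'"
  define B where "B = max 0 (\<rho> (2 * ?d' x + 3 * C))"
  have d0: "0 \<le> ?d u" if "u \<in> mspace X" for u using point_dist_nonneg[OF Z that] .
  have M': "p' \<in> mspace X" "q' \<in> mspace X" using p' q' Z' by (auto dest: projD)
  have le': "?d' u \<le> ?d u + C" if u: "u \<in> mspace X" for u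
  proof -
    obtain p where p: "p \<in> proj X Z u" using proximinal_projE[OF Z u] .
    then obtain z' where z': "z' \<in> Z'" "mdist X p z' \<le> C" using close(2) projD by metis
    have "mdist X u z' \<le> mdist X u p + mdist X p z'"
      using u p z' proximinalD[OF Z] Z' by (intro mdist_triangle) (auto dest: projD)
    then show ?thesis using projD[OF p] z' point_dist_le[OF z'(1), of X u] by linarith
  qed
  have dB: "\<rho> r \<le> B" if "0 \<le> r" "r \<le> 2 * ?d' x + 3 * C" for r
    using mono_onD[OF mono, of r "2 * ?d' x + 3 * C"] that by (auto simp: B_def)
  have ge': "?d u \<le> ?d' u + C" if "u \<in> mspace X" "v \<in> proj X Z' u" for u v
  proof -
    have "?d u \<le> mdist X u v + ?d v"
      using that Z' by (intro point_dist_triangle[OF Z]) (auto dest: projD)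
    then show ?thesis using projD[OF that(2)] close(1)[of v] by linarith
  qed
  have dx: "?d x \<le> ?d' x + C" using ge'[OF x p'] .
  have dy: "?d y \<le> 2 * ?d' x + C"
    using point_dist_triangle[OF Z y x] dx xy by (simp add: mdist_commute)
  have d'0: "0 \<le> ?d' x" using xy mdist_nonneg[of X x y] by linarith
  have near: "mdist X p p' \<le> B + (4 * C + 4)"
    if u: "u \<in> mspace X" "p' \<in> proj X Z' u" "p \<in> proj X Z u" "?d u \<le> 2 * ?d' x + 3 * C" for u p p'
  proof -
    have p': "p' \<in> mspace X" "p' \<in> Z'" "mdist X u p' = ?d' u" using projD[OF u(2)] Z' by auto
    obtain w where w: "w \<in> mspace X" "mdist X u w \<le> ?d u" "mdist X w p' \<le> C + 1"
      using length_space_between[OF X u(1) p'(1) d0[OF u(1)] C] le'[OF u(1)] p'(3) by auto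
    obtain v where v: "v \<in> proj X Z w" using proximinal_projE[OF Z w(1)] .
    have vM: "v \<in> mspace X" "p \<in> mspace X" using projD[OF v] projD[OF u(3)] proximinalD[OF Z] by blast+
    have "mdist X p v \<le> \<rho> (?d u)" using \<rho> u w v unfolding proj_bound_def by blast
    also have "\<dots> \<le> B" using dB[OF d0[OF u(1)] u(4)] .
    finally have "mdist X p v \<le> B" .
    moreover have "mdist X p p' \<le> mdist X p v + mdist X v p'" using vM p' by (intro mdist_triangle)
    moreover have "mdist X v p' \<le> mdist X v w + mdist X w p'" using vM p' w by (intro mdist_triangle)
    moreover have "?d w \<le> mdist X w p' + ?d p'" using point_dist_triangle[OF Z w(1) p'(1)] .
    ultimately show ?thesis using close(1)[OF p'(2)] w(3) projD[OF v] C by (simp add: mdist_commute)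
  qed
  obtain p where p: "p \<in> proj X Z x" using proximinal_projE[OF Z x] .
  obtain q where q: "q \<in> proj X Z y" using proximinal_projE[OF Z y] .
  \<comment> \<open>\<open>y\<close> itself may lie up to \<open>C\<close> beyond the radius
    \<open>?d x\<close> in which contraction of \<open>Z\<close> applies, so a point
    \<open>w\<close> within that radius and close to \<open>y\<close> stands in for it.\<close>
  obtain w where w: "w \<in> mspace X" "mdist X x w \<le> ?d x" "mdist X w y \<le> C + 1"
    using length_space_between[OF X x y d0[OF x] C] le'[OF x] xy by auto
  obtain v where v: "v \<in> proj X Z w" using proximinal_projE[OF Z w(1)] .
  have M: "p \<in> mspace X" "q \<in> mspace X" "v \<in> mspace X"
    using projD[OF p] projD[OF q] projD[OF v] proximinalD[OF Z] by blast+
  have 1: "mdist X p p' \<le> B + (4 * C + 4)" using near[OF x p' p] dx C d'0 by simp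
  have 2: "mdist X q q' \<le> B + (4 * C + 4)" using near[OF y q' q] dy C by simp
  have "mdist X p v \<le> \<rho> (?d x)" using \<rho> x w p v unfolding proj_bound_def by blast
  also have "\<dots> \<le> B" using dB[OF d0[OF x]] dx C d'0 by simp
  finally have 3: "mdist X p v \<le> B" .
  have 4: "mdist X v q \<le> B + 4 * (C + 1)"
    using proj_bound_near[OF Z \<rho> mono w(1) y w(3) _ _ v q, of "2 * ?d' x + 3 * C"] dy C by (simp add: B_def)
  \<comment> \<open>The chain \<open>p'\<close>, \<open>p\<close>, \<open>v\<close>,
    \<open>q\<close>, \<open>q'\<close> has four legs, each contributing one \<open>B\<close>; hence
    the factor 4.\<close>
  have "mdist X p' q' \<le> mdist X p' p + mdist X p q'" using M M' by (intro mdist_triangle)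
  moreover have "mdist X p q' \<le> mdist X p v + mdist X v q'" using M M' by (intro mdist_triangle)
  moreover have "mdist X v q' \<le> mdist X v q + mdist X q q'" using M M' by (intro mdist_triangle)
  ultimately show "mdist X p' q' \<le> 4 * max 0 (\<rho> (2 * ?d' x + 3 * C)) + (16 * C + 12)"
    unfolding B_def[symmetric] using 1 2 3 4 C by (simp add: mdist_commute)
qed

text \<open>With \<open>s = 2 * r + 3 * C\<close> the quotient \<open>\<rho> s / r\<close> is
  \<open>\<rho> s / s\<close> times \<open>s / r\<close>, and these factors tend to 0 and 2.\<close>

lemma sublinear_hausdorff:
  assumes \<rho>: "sublinear \<rho>" and C: "0 \<le> C" and a: "0 \<le> a" and b: "0 \<le> b"
  shows "sublinear (\<lambda>r. a * max 0 (\<rho> (2 * r + 3 * C)) + b)"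
  unfolding sublinear_def
proof (intro conjI)
  have mono: "mono_on {0..} \<rho>" and lim: "((\<lambda>r. \<rho> r / r) \<longlongrightarrow> 0) at_top"
    using \<rho> by (auto simp: sublinear_def)
  show "mono_on {0..} (\<lambda>r. a * max 0 (\<rho> (2 * r + 3 * C)) + b)"
  proof (rule mono_onI)
    fix r s :: real assume "r \<in> {0..}" "s \<in> {0..}" "r \<le> s"
    then have "\<rho> (2 * r + 3 * C) \<le> \<rho> (2 * s + 3 * C)" using C by (intro mono_onD[OF mono]) auto
    then show "a * max 0 (\<rho> (2 * r + 3 * C)) + b \<le> a * max 0 (\<rho> (2 * s + 3 * C)) + b"
      using a by (intro add_right_mono mult_left_mono) auto
  qed
  show "\<forall>\<^sub>F r in at_top. 0 \<le> a * max 0 (\<rho> (2 * r + 3 * C)) + b" using a b by simp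
  have top: "filterlim (\<lambda>r. 2 * r + 3 * C) at_top at_top" by real_asymp
  have "((\<lambda>r. (2 * r + 3 * C) / r) \<longlongrightarrow> 2) at_top" by real_asymp
  from tendsto_mult[OF filterlim_compose[OF lim top] this]
  have prod: "((\<lambda>r. \<rho> (2 * r + 3 * C) / (2 * r + 3 * C) * ((2 * r + 3 * C) / r)) \<longlongrightarrow> 0) at_top" by simp
  have "\<forall>\<^sub>F r in at_top. 2 * r + 3 * C \<noteq> 0"
    by (rule eventually_mono[OF eventually_gt_at_top[of 0]]) (use C in linarith)
  then have "\<forall>\<^sub>F r in at_top. \<rho> (2 * r + 3 * C) / (2 * r + 3 * C) * ((2 * r + 3 * C) / r) = \<rho> (2 * r + 3 * C) / r"
    by eventually_elim simp
  with prod have "((\<lambda>r. \<rho> (2 * r + 3 * C) / r) \<longlongrightarrow> 0) at_top" by (rule Lim_transform_eventually)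
  then have "((\<lambda>r. max 0 (\<rho> (2 * r + 3 * C) / r)) \<longlongrightarrow> max 0 0) at_top" by (intro tendsto_max tendsto_const)
  moreover have "((\<lambda>r. b / r) \<longlongrightarrow> 0) at_top" by real_asymp
  ultimately have "((\<lambda>r. a * max 0 (\<rho> (2 * r + 3 * C) / r) + b / r) \<longlongrightarrow> a * max 0 0 + 0) at_top"
    by (intro tendsto_add tendsto_mult tendsto_const)
  then have "((\<lambda>r. a * max 0 (\<rho> (2 * r + 3 * C) / r) + b / r) \<longlongrightarrow> 0) at_top" by simp
  moreover have "\<forall>\<^sub>F r in at_top. a * max 0 (\<rho> (2 * r + 3 * C) / r) + b / r = (a * max 0 (\<rho> (2 * r + 3 * C)) + b) / r"
    using eventually_gt_at_top[of 0] by eventually_elim (auto simp: max_def add_divide_distrib divide_le_0_iff zero_le_divide_iff)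
  ultimately show "((\<lambda>r. (a * max 0 (\<rho> (2 * r + 3 * C)) + b) / r) \<longlongrightarrow> 0) at_top"
    by (rule Lim_transform_eventually)
qed

section \<open>Pointwise bounds, diameters and thresholds\<close>

lemma proj_union_bound:
  assumes Z: "proximinal X Z" and \<rho>: "proj_bound X \<rho> Z"
    and xy: "x \<in> mspace X" "y \<in> mspace X" "mdist X x y \<le> point_dist X x Z"
    and ab: "a \<in> proj X Z x \<union> proj X Z y" "b \<in> proj X Z x \<union> proj X Z y"
  shows "mdist X a b \<le> 2 * \<rho> (point_dist X x Z)"
proof -
  let ?R = "\<rho> (point_dist X x Z)"
  \<comment> \<open>All points of the union are compared with one \<open>p\<close>, applying the
    bound to the pair \<open>x\<close>, \<open>x\<close> as well as to \<open>x\<close>,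
    \<open>y\<close>. This detour is the factor 2.\<close>
  obtain p where p: "p \<in> proj X Z x" using proximinal_projE[OF Z xy(1)] .
  have "mdist X x x = 0" using xy by simp
  then have "mdist X p c \<le> ?R" if "c \<in> proj X Z x \<union> proj X Z y" for c
    using \<rho> xy p that point_dist_nonneg[OF Z xy(1)] unfolding proj_bound_def by (metis UnE)
  from this[OF ab(1)] this[OF ab(2)] have "mdist X a p + mdist X p b \<le> 2 * ?R" by (simp add: mdist_commute)
  moreover have "a \<in> mspace X" "p \<in> mspace X" "b \<in> mspace X"
    using ab p proximinalD[OF Z] by (auto dest: projD)
  ultimately show ?thesis using mdist_triangle by (metis order_trans)
qed

lemma diam_proj_le:
  assumes Z: "proximinal X Z" and \<rho>: "proj_bound X \<rho> Z"
    and xy: "x \<in> mspace X" "y \<in> mspace X" "mdist X x y \<le> point_dist X x Z"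
  shows "diam X (proj X Z x \<union> proj X Z y) \<le> 2 * \<rho> (point_dist X x Z)"
proof -
  have "proj X Z x \<noteq> {}" using proximinal_projE[OF Z xy(1)] by auto
  then show ?thesis
    unfolding diam_def using proj_union_bound[OF Z \<rho> xy] by (auto intro!: cSup_least)
qed

text \<open>\<open>diam\<close> is a supremum of reals and bounds its elements only for a bounded
  set; here everything lies within \<open>B\<close> of \<open>x\<close>.\<close>

lemma mdist_le_diam_proj:
  assumes Z: "proximinal X Z" and xy: "x \<in> mspace X" "y \<in> mspace X"
    and ab: "a \<in> proj X Z x \<union> proj X Z y" "b \<in> proj X Z x \<union> proj X Z y"
  shows "mdist X a b \<le> diam X (proj X Z x \<union> proj X Z y)"
proof -
  let ?S = "proj X Z x \<union> proj X Z y"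
  define B where "B = point_dist X x Z + mdist X x y + point_dist X y Z"
  have pos: "0 \<le> point_dist X x Z" "0 \<le> point_dist X y Z" using point_dist_nonneg[OF Z] xy by auto
  have c: "mdist X x c \<le> B" "c \<in> mspace X" if "c \<in> ?S" for c
  proof -
    show M: "c \<in> mspace X" using that proximinalD[OF Z] by (auto dest: projD)
    show "mdist X x c \<le> B"
      using that projD[of c X Z x] projD[of c X Z y] mdist_triangle[OF xy M] pos mdist_nonneg[of X x y]
      unfolding B_def by auto
  qed
  have "bdd_above {mdist X a b |a b. a \<in> ?S \<and> b \<in> ?S}"
  proof (rule bdd_aboveI[of _ "2 * B"], clarify)
    fix a b assume ab: "a \<in> ?S" "b \<in> ?S"
    have "mdist X a b \<le> mdist X a x + mdist X x b" using c(2)[OF ab(1)] c(2)[OF ab(2)] xy by (intro mdist_triangle)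
    then show "mdist X a b \<le> 2 * B" using c(1)[OF ab(1)] c(1)[OF ab(2)] by (simp add: mdist_commute)
  qed
  then have "mdist X a b \<le> Sup {mdist X a b |a b. a \<in> ?S \<and> b \<in> ?S}"
    using ab by (intro cSup_upper) auto
  then show ?thesis using ab by (auto simp: diam_def)
qed

lemma rho_contracting_proj_bound:
  assumes "proximinal X Z" "rho_contracting X \<rho> Z"
  shows "proj_bound X \<rho> Z"
  unfolding proj_bound_def
proof (intro ballI impI)
  fix x y p q assume "x \<in> mspace X" "y \<in> mspace X" "mdist X x y \<le> point_dist X x Z" "p \<in> proj X Z x" "q \<in> proj X Z y"
  then show "mdist X p q \<le> \<rho> (point_dist X x Z)"
    using mdist_le_diam_proj[OF assms(1), of x y p q] assms(2) unfolding rho_contracting_def by fastforce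
qed

lemma sublinear_cmult:
  assumes "sublinear \<rho>" "0 \<le> c"
  shows "sublinear (\<lambda>r. c * \<rho> r)"
proof -
  have "((\<lambda>r. c * (\<rho> r / r)) \<longlongrightarrow> c * 0) at_top"
    using assms(1) by (intro tendsto_mult tendsto_const) (simp add: sublinear_def)
  moreover have "\<forall>\<^sub>F r in at_top. 0 \<le> c * \<rho> r"
    using assms by (auto simp: sublinear_def elim!: eventually_mono)
  ultimately show ?thesis
    using assms by (auto simp: sublinear_def monotone_on_def intro: mult_left_mono)
qed

lemma contractingI:
  assumes "proximinal X Z" "proj_bound X \<rho> Z" "sublinear \<rho>"
  shows "contracting X Z"
  unfolding contracting_def
proof (intro exI conjI)
  show "rho_contracting X (\<lambda>r. 2 * \<rho> r) Z"
    unfolding rho_contracting_def using proximinal_closedin[OF assms(1)] diam_proj_le[OF assms(1,2)] by blast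
  show "sublinear (\<lambda>r. 2 * \<rho> r)" using sublinear_cmult[OF assms(3)] by simp
qed

text \<open>Stated for a function dominated by a sublinear one, since
  \<open>rho_of X \<zeta>\<close> is accessible through such a bound.\<close>

lemma sublinear_threshold:
  assumes \<sigma>: "sublinear \<sigma>" and le: "\<And>r. 0 \<le> r \<Longrightarrow> \<rho> r \<le> \<sigma> r" and L: "1 \<le> L"
  shows "qg_threshold \<rho> L A (kappa \<rho> L A)"
proof -
  let ?S = "{R. R > 0 \<and> (\<forall>r\<ge>R. 3 * L\<^sup>2 * \<rho> r \<le> r)}"
  have L0: "0 < 3 * L\<^sup>2" using L by simp
  have "\<forall>\<^sub>F r in at_top. \<sigma> r / r < 1 / (3 * L\<^sup>2)"
    using \<sigma> L0 by (intro order_tendstoD[where y = 0]) (auto simp: sublinear_def)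
  then obtain R0 where R0: "\<And>r. R0 \<le> r \<Longrightarrow> \<sigma> r / r < 1 / (3 * L\<^sup>2)" by (auto simp: eventually_at_top_linorder)
  have "3 * L\<^sup>2 * \<rho> r \<le> r" if "max R0 1 \<le> r" for r
  proof -
    have r: "0 < r" "R0 \<le> r" using that by auto
    have "\<rho> r / r \<le> \<sigma> r / r" using le r by (intro divide_right_mono) auto
    also have "\<dots> < 1 / (3 * L\<^sup>2)" using R0 r by simp
    finally show ?thesis using r L0 by (simp add: field_simps)
  qed
  then have ne: "max R0 1 \<in> ?S" by auto
  have K: "3 * A \<le> kappa \<rho> L A" "3 * L\<^sup>2 \<le> kappa \<rho> L A" "1 + Inf ?S \<le> kappa \<rho> L A"
    unfolding kappa_def by (auto intro: Max_ge)
  \<comment> \<open>The summand 1 in \<open>kappa\<close> makes the inequality strict, so some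
    member of \<open>?S\<close> lies below \<open>kappa\<close> even if the infimum is not
    attained.\<close>
  then have "Inf ?S < kappa \<rho> L A" by linarith
  then obtain R where "R \<in> ?S" "R < kappa \<rho> L A" using cInf_lessD[of ?S] ne by blast
  then show ?thesis using K by (auto simp: qg_threshold_def)
qed

section \<open>The boundary as a quotient\<close>

lemma finite_hausdorff_dist_sym:
  "finite_hausdorff_dist X A B \<Longrightarrow> finite_hausdorff_dist X B A"
  unfolding finite_hausdorff_dist_def by (metis mdist_commute)

lemma finite_hausdorff_dist_trans:
  assumes "finite_hausdorff_dist X A B" "finite_hausdorff_dist X B C"
    and M: "A \<subseteq> mspace X" "B \<subseteq> mspace X" "C \<subseteq> mspace X"
  shows "finite_hausdorff_dist X A C"
proof -
  obtain c d where c: "\<forall>a\<in>A. \<exists>b\<in>B. mdist X a b \<le> c" "\<forall>b\<in>B. \<exists>a\<in>A. mdist X a b \<le> c"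
    and d: "\<forall>a\<in>B. \<exists>b\<in>C. mdist X a b \<le> d" "\<forall>b\<in>C. \<exists>a\<in>B. mdist X a b \<le> d"
    using assms(1,2) unfolding finite_hausdorff_dist_def by blast
  have tri: "mdist X x z \<le> c + d"
    if "x \<in> A" "y \<in> B" "z \<in> C" "mdist X x y \<le> c" "mdist X y z \<le> d" for x y z
    using mdist_triangle[of x X y z] that M by (meson add_mono order_trans subsetD)
  have "\<exists>z\<in>C. mdist X x z \<le> c + d" if "x \<in> A" for x using c(1) d(1) tri that by meson
  moreover have "\<exists>x\<in>A. mdist X x z \<le> c + d" if "z \<in> C" for z using c(2) d(2) tri that by meson
  ultimately show ?thesis unfolding finite_hausdorff_dist_def by blast
qed

lemma contracting_ray_image: "\<beta> \<in> contracting_rays X p \<Longrightarrow> ray_image \<beta> \<subseteq> mspace X"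
  by (auto simp: contracting_rays_def quasi_geodesic_ray_def PiE_iff)

lemma boundary_equiv:
  "equiv (contracting_rays X p) {(\<beta>, \<gamma>) \<in> contracting_rays X p \<times> contracting_rays X p.
          finite_hausdorff_dist X (ray_image \<beta>) (ray_image \<gamma>)}"
proof (rule equivI)
  show "refl_on (contracting_rays X p) {(\<beta>, \<gamma>) \<in> contracting_rays X p \<times> contracting_rays X p.
          finite_hausdorff_dist X (ray_image \<beta>) (ray_image \<gamma>)}"
  proof (rule refl_onI)
    fix \<beta> assume \<beta>: "\<beta> \<in> contracting_rays X p"
    have "mdist X x x = 0" if "x \<in> ray_image \<beta>" for x using contracting_ray_image[OF \<beta>] that by auto
    then have "mdist X x x \<le> 0" if "x \<in> ray_image \<beta>" for x using that by simp
    then have "finite_hausdorff_dist X (ray_image \<beta>) (ray_image \<beta>)"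
      unfolding finite_hausdorff_dist_def by (intro exI[of _ 0]) blast
    with \<beta> show "(\<beta>, \<beta>) \<in> {(\<beta>, \<gamma>) \<in> contracting_rays X p \<times> contracting_rays X p.
          finite_hausdorff_dist X (ray_image \<beta>) (ray_image \<gamma>)}" by simp
  qed
qed (auto intro!: symI transI intro: finite_hausdorff_dist_sym
      finite_hausdorff_dist_trans[OF _ _ contracting_ray_image contracting_ray_image contracting_ray_image])

lemma boundary_finite_hausdorff_dist:
  assumes "\<eta> \<in> contracting_boundary X p" "\<beta> \<in> \<eta>" "\<gamma> \<in> \<eta>"
  shows "finite_hausdorff_dist X (ray_image \<beta>) (ray_image \<gamma>)"
  using quotient_eq_iff[OF boundary_equiv assms(1)[unfolded contracting_boundary_def]
      assms(1)[unfolded contracting_boundary_def] assms(2,3)] by simp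

lemma boundary_memI:
  assumes "\<eta> \<in> contracting_boundary X p" "\<gamma> \<in> \<eta>" "\<beta> \<in> contracting_rays X p"
    and "finite_hausdorff_dist X (ray_image \<gamma>) (ray_image \<beta>)"
  shows "\<beta> \<in> \<eta>"
  using in_quotient_imp_closed[OF boundary_equiv assms(1)[unfolded contracting_boundary_def] assms(2)]
    boundary_point_ray[OF assms(1,2)] assms(3,4) by simp

section \<open>Redirecting quasi-geodesics\<close>

lemma qg_threshold_mono:
  assumes "qg_threshold \<rho> L A K" "K \<le> K'"
  shows "qg_threshold \<rho> L A K'"
  using assms by (auto simp: qg_threshold_def)

lemma cqg_ray_mono:
  assumes \<beta>: "cqg_ray X L A \<beta>" and "1 \<le> L" "L \<le> L'" "A \<le> A'"
  shows "cqg_ray X L' A' \<beta>"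
proof -
  have "\<bar>s - t\<bar> / L' - A' \<le> mdist X (\<beta> s) (\<beta> t) \<and> mdist X (\<beta> s) (\<beta> t) \<le> L' * \<bar>s - t\<bar> + A'"
    if "0 \<le> s" "0 \<le> t" for s t
  proof -
    have "\<bar>s - t\<bar> / L' \<le> \<bar>s - t\<bar> / L" using assms by (intro divide_left_mono) auto
    moreover have "L * \<bar>s - t\<bar> \<le> L' * \<bar>s - t\<bar>" using assms by (intro mult_right_mono) auto
    ultimately show ?thesis using cqg_rayD(2,3)[OF \<beta> that] assms by linarith
  qed
  then show ?thesis using \<beta> by (auto simp: cqg_ray_def quasi_geodesic_ray_def)
qed

text \<open>The time spent on \<open>\<tau>\<close> is controlled by \<open>lower\<close>, and then
  the triangle inequality through \<open>\<beta> t\<close> controls the time spent on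
  \<open>\<beta>\<close>. The constants of \<open>\<tau>\<close> are absolute, so the new ones are
  linear in \<open>n\<close>.\<close>

lemma cqg_ray_splice:
  assumes \<beta>: "cqg_ray X n n \<beta>" and n: "1 \<le> n" and t: "0 \<le> t"
    and \<tau>: "\<And>v. 0 \<le> v \<Longrightarrow> \<tau> v \<in> mspace X" "\<tau> 0 = \<beta> t"
      "\<And>v w. 0 \<le> v \<Longrightarrow> 0 \<le> w \<Longrightarrow> mdist X (\<tau> v) (\<tau> w) \<le> \<bar>v - w\<bar>"
    and lower: "\<And>v w. 0 \<le> v \<Longrightarrow> v \<le> w \<Longrightarrow> w - v \<le> 2 * mdist X (\<tau> v) (\<tau> w) + 4"
      "\<And>u w. 0 \<le> u \<Longrightarrow> u \<le> t \<Longrightarrow> 0 \<le> w \<Longrightarrow> w \<le> 2 * mdist X (\<beta> u) (\<tau> w) + 4"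
  shows "cqg_ray X (5 * n + 5) (5 * n + 5) (\<lambda>u\<in>{0..}. if u \<le> t then \<beta> u else \<tau> (u - t))"
proof -
  let ?L = "5 * n + 5"
  define \<delta> where "\<delta> = (\<lambda>u\<in>{0..}. if u \<le> t then \<beta> u else \<tau> (u - t))"
  have \<delta>1: "\<delta> u = \<beta> u" if "0 \<le> u" "u \<le> t" for u using that by (simp add: \<delta>_def)
  have \<delta>2: "\<delta> u = \<tau> (u - t)" if "t < u" for u using that t by (simp add: \<delta>_def)
  have M: "\<beta> u \<in> mspace X" if "0 \<le> u" for u using cqg_rayD(1)[OF \<beta>] that by auto
  have \<delta>: "\<delta> \<in> {0..} \<rightarrow>\<^sub>E mspace X" using M \<tau>(1) by (auto simp: \<delta>_def)
  then have \<delta>M: "\<delta> \<in> {0..} \<rightarrow> mspace X" by (auto simp: PiE_iff)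
  \<comment> \<open>All three cases below end in the bound
    \<open>5 * n * m + n\<^sup>2 + 8 * n\<close>, which the constant \<open>5 * n + 5\<close> has to
    accommodate.\<close>
  have lo: "x / ?L - ?L \<le> m" if "x \<le> 5 * n * m + n\<^sup>2 + 8 * n" "0 \<le> m" for x m
  proof -
    have "?L * (m + ?L) = 5 * n * m + n\<^sup>2 + 8 * n + (24 * n\<^sup>2 + 42 * n + 5 * m + 25)"
      by (simp add: algebra_simps power2_eq_square)
    moreover have "0 \<le> 24 * n\<^sup>2 + 42 * n + 5 * m + 25" using n that by simp
    ultimately have "x \<le> (m + ?L) * ?L" using that by (simp add: mult.commute)
    then have "x / ?L \<le> m + ?L" using n by (subst pos_divide_le_eq) auto
    then show ?thesis by simp
  qed
  have ordered: "(v - u) / ?L - ?L \<le> mdist X (\<delta> u) (\<delta> v) \<and> mdist X (\<delta> u) (\<delta> v) \<le> ?L * (v - u) + ?L"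
    if uv: "0 \<le> u" "u \<le> v" for u v
  proof -
    let ?m = "mdist X (\<delta> u) (\<delta> v)"
    have weak: "?m \<le> ?L * (v - u) + ?L" if "?m \<le> n * (v - u) + n"
    proof -
      have "n * (v - u) \<le> ?L * (v - u)" using uv n by (intro mult_right_mono) auto
      then show ?thesis using that n by linarith
    qed
    have mn: "?m \<le> n * ?m" using mult_right_mono[OF n mdist_nonneg[of X "\<delta> u" "\<delta> v"]] by simp
    have n2: "n \<le> n\<^sup>2" using n by (simp add: power2_eq_square)
    consider "v \<le> t" | "u \<le> t" "t < v" | "t < u" using uv by linarith
    then have "v - u \<le> 5 * n * ?m + n\<^sup>2 + 8 * n \<and> ?m \<le> n * (v - u) + n"
    proof cases
      case 1
      then have m: "?m = mdist X (\<beta> u) (\<beta> v)" using uv \<delta>1 by simp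
      have "(v - u) / n - n \<le> ?m" "?m \<le> n * (v - u) + n"
        unfolding m using cqg_rayD(2,3)[OF \<beta>, of u v] uv by auto
      moreover from this(1) have "v - u \<le> n * ?m + n\<^sup>2" using n by (simp add: field_simps power2_eq_square)
      ultimately show ?thesis using mn n mdist_nonneg[of X "\<delta> u" "\<delta> v"] by linarith
    next
      case 2
      define w where "w = v - t"
      have w: "0 \<le> w" using 2 by (simp add: w_def)
      have m: "?m = mdist X (\<beta> u) (\<tau> w)" using uv 2 \<delta>1 \<delta>2 by (simp add: w_def)
      have w_le: "w \<le> 2 * ?m + 4" unfolding m using lower(2) uv 2 w by simp
      have \<tau>w: "mdist X (\<tau> w) (\<beta> t) \<le> w" using \<tau>(2) \<tau>(3)[of w 0] w by simp
      have "mdist X (\<beta> u) (\<beta> t) \<le> ?m + mdist X (\<tau> w) (\<beta> t)"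
        unfolding m using M \<tau>(1) uv t w by (intro mdist_triangle) auto
      moreover have "(t - u) / n - n \<le> mdist X (\<beta> u) (\<beta> t)" using cqg_rayD(2)[OF \<beta>, of u t] uv 2 t by simp
      ultimately have "(t - u) / n \<le> ?m + w + n" using \<tau>w by linarith
      then have "(t - u) / n \<le> 3 * ?m + 4 + n" using w_le by linarith
      then have "t - u \<le> 3 * (n * ?m) + 4 * n + n\<^sup>2" using n by (simp add: field_simps power2_eq_square)
      then have 1: "v - u \<le> 5 * n * ?m + n\<^sup>2 + 8 * n" using w_le mn n unfolding w_def by linarith
      have "?m \<le> mdist X (\<beta> u) (\<beta> t) + mdist X (\<beta> t) (\<tau> w)"
        unfolding m using M \<tau>(1) uv t w by (intro mdist_triangle) auto
      also have "mdist X (\<beta> u) (\<beta> t) \<le> n * (t - u) + n" using cqg_rayD(3)[OF \<beta>, of u t] uv 2 t by simp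
      finally have "?m \<le> n * (t - u) + n + w" using \<tau>w by (simp add: mdist_commute)
      also have "w \<le> n * w" using mult_right_mono[OF n w] by simp
      finally have "?m \<le> n * (v - u) + n" by (simp add: w_def algebra_simps)
      with 1 show ?thesis by simp
    next
      case 3
      then have m: "?m = mdist X (\<tau> (u - t)) (\<tau> (v - t))" using uv t \<delta>2 by simp
      have "v - u \<le> 2 * ?m + 4" unfolding m using lower(1)[of "u - t" "v - t"] 3 uv by simp
      moreover have "?m \<le> v - u" unfolding m using \<tau>(3)[of "u - t" "v - t"] 3 uv by simp
      moreover have "v - u \<le> n * (v - u)" using mult_right_mono[OF n, of "v - u"] uv by simp
      moreover have "0 \<le> n\<^sup>2" by simp
      ultimately show ?thesis using mn n mdist_nonneg[of X "\<delta> u" "\<delta> v"] by linarith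
    qed
    then show ?thesis using lo[OF _ mdist_nonneg[of X "\<delta> u" "\<delta> v"]] weak by blast
  qed
  have "\<bar>u - v\<bar> / ?L - ?L \<le> mdist X (\<delta> u) (\<delta> v) \<and> mdist X (\<delta> u) (\<delta> v) \<le> ?L * \<bar>u - v\<bar> + ?L"
    if "0 \<le> u" "0 \<le> v" for u v
  proof (cases "u \<le> v")
    case True
    then show ?thesis using ordered[OF that(1), of v] by (simp add: abs_minus_commute)
  next
    case False
    then show ?thesis using ordered[OF that(2), of u] by (simp add: mdist_commute)
  qed
  then have qg: "quasi_geodesic_ray X ?L ?L \<delta>"
    unfolding quasi_geodesic_ray_def using \<delta> by blast
  \<comment> \<open>Clamping times at \<open>t\<close> reduces continuity of the spliced ray to that
    of \<open>\<beta>\<close>, with no separate case at the junction.\<close>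
  have step: "mdist X (\<delta> u) (\<delta> v) \<le> mdist X (\<beta> (min u t)) (\<beta> (min v t)) + \<bar>u - v\<bar>"
    if "0 \<le> u" "0 \<le> v" for u v
  proof -
    have *: "mdist X (\<delta> u) (\<delta> v) \<le> mdist X (\<beta> (min u t)) (\<beta> (min v t)) + \<bar>u - v\<bar>"
      if "0 \<le> u" "u \<le> v" for u v
    proof -
      consider "v \<le> t" | "u \<le> t" "t < v" | "t < u" using that by linarith
      then show ?thesis
      proof cases
        case 2
        have "mdist X (\<beta> u) (\<tau> (v - t)) \<le> mdist X (\<beta> u) (\<beta> t) + mdist X (\<tau> 0) (\<tau> (v - t))"
          using mdist_triangle[of "\<beta> u" X "\<beta> t" "\<tau> (v - t)"] M \<tau>(1,2) that 2 t by simp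
        then show ?thesis using that 2 \<tau>(3)[of 0 "v - t"] \<delta>1[of u] \<delta>2[of v] by simp
      next
        case 3
        have "mdist X (\<tau> (u - t)) (\<tau> (v - t)) \<le> \<bar>u - v\<bar>" using \<tau>(3)[of "u - t" "v - t"] 3 that by simp
        moreover have "mdist X (\<beta> t) (\<beta> t) = 0" using M[OF t] by simp
        ultimately show ?thesis using that 3 t \<delta>2[of u] \<delta>2[of v] by simp
      qed (use that \<delta>1 in auto)
    qed
    show ?thesis using *[of u v] *[of v u] that by (cases "u \<le> v") (auto simp: mdist_commute abs_minus_commute)
  qed
  have \<beta>c: "\<beta> \<in> {0..} \<rightarrow> mspace X" "continuous_ray X \<beta>" using M \<beta> by (auto simp: cqg_ray_def)
  have "continuous_ray X \<delta>"
    unfolding continuous_ray_iff[OF \<delta>M]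
  proof (intro allI impI)
    fix v e :: real assume v: "0 \<le> v" and e: "0 < e"
    then have "0 \<le> min v t" "0 < e / 2" using t by auto
    then obtain d where d: "0 < d" "\<And>s. 0 \<le> s \<Longrightarrow> \<bar>s - min v t\<bar> < d \<Longrightarrow> mdist X (\<beta> s) (\<beta> (min v t)) < e / 2"
      using \<beta>c(2)[unfolded continuous_ray_iff[OF \<beta>c(1)], rule_format, of "min v t" "e / 2"] by blast
    have "mdist X (\<delta> u) (\<delta> v) < e" if u: "0 \<le> u" "\<bar>u - v\<bar> < min d (e / 2)" for u
    proof -
      have "\<bar>min u t - min v t\<bar> < d"
      proof -
        have "\<bar>min u t - min v t\<bar> \<le> \<bar>u - v\<bar>" by linarith
        then show ?thesis using u(2) by simp
      qed
      then have "mdist X (\<beta> (min u t)) (\<beta> (min v t)) < e / 2" using d(2) u t by simp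
      then show ?thesis using step[OF u(1) v] u(2) by simp
    qed
    then show "\<exists>d>0. \<forall>s\<ge>0. \<bar>s - v\<bar> < d \<longrightarrow> mdist X (\<delta> s) (\<delta> v) < e"
      using d(1) e by (intro exI[of _ "min d (e / 2)"]) simp
  qed
  with qg show ?thesis by (simp add: cqg_ray_def \<delta>_def)
qed

lemma cqg_ray_redirect:
  assumes X: "length_space X" and \<beta>: "cqg_ray X n n \<beta>" and n: "1 \<le> n" and \<gamma>: "geodesic_ray X \<gamma>"
    and start: "\<beta> 0 = \<gamma> 0" and TS: "0 \<le> T" "0 \<le> S" "mdist X (\<beta> T) (\<gamma> S) \<le> K"
  obtains \<delta> t T' S' where "cqg_ray X (5 * n + 5) (5 * n + 5) \<delta>"
    "0 \<le> t" "\<And>u. 0 \<le> u \<Longrightarrow> u \<le> t \<Longrightarrow> \<delta> u = \<beta> u" "\<And>u. t \<le> u \<Longrightarrow> S - 2 * K - 3 \<le> mdist X (\<gamma> 0) (\<delta> u)"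
    "0 \<le> T'" "0 \<le> S'" "\<And>u. 0 \<le> u \<Longrightarrow> \<delta> (T' + u) = \<gamma> (S' + u)"
proof -
  have M: "\<beta> u \<in> mspace X" if "0 \<le> u" for u using cqg_rayD(1)[OF \<beta>] that by auto
  have g: "mdist X (\<gamma> s) (\<gamma> t) = \<bar>s - t\<bar>" if "0 \<le> s" "0 \<le> t" for s t
    using \<gamma> that by (auto simp: geodesic_ray_def)
  have gM: "\<gamma> s \<in> mspace X" if "0 \<le> s" for s
    using \<gamma> that by (auto simp: geodesic_ray_def PiE_iff)
  \<comment> \<open>The switching pair \<open>(t, s)\<close> almost minimizes \<open>?F\<close> on \<open>[0, T] \<times> [0, \<infinity>)\<close>. The term \<open>s / 2\<close> makes all
    points of \<open>\<gamma>\<close> beyond \<open>s\<close> linearly far from \<open>\<beta>\<close> up to \<open>t\<close>, whatever \<open>K\<close> is, and pushes \<open>s\<close> out to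
    about \<open>S\<close>.\<close>
  let ?F = "\<lambda>u s. mdist X (\<beta> u) (\<gamma> s) - s / 2"
  let ?V = "{?F u s | u s. 0 \<le> u \<and> u \<le> T \<and> 0 \<le> s}"
  \<comment> \<open>Far along \<open>\<gamma>\<close> the distance to the bounded piece of
    \<open>\<beta>\<close> grows like \<open>s\<close>, which beats \<open>s / 2\<close>.\<close>
  have bdd: "bdd_below ?V"
  proof (rule bdd_belowI[of _ "- (n * T + n)"], clarify)
    fix u s :: real assume us: "0 \<le> u" "u \<le> T" "0 \<le> s"
    have "mdist X (\<gamma> 0) (\<gamma> s) \<le> mdist X (\<gamma> 0) (\<beta> u) + mdist X (\<beta> u) (\<gamma> s)"
      using us M gM by (intro mdist_triangle) auto
    moreover have "mdist X (\<gamma> 0) (\<beta> u) \<le> n * u + n" using cqg_rayD(3)[OF \<beta>, of 0 u] us start by simp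
    moreover have "n * u \<le> n * T" using us n by (intro mult_left_mono) auto
    ultimately show "- (n * T + n) \<le> ?F u s" using g[of 0 s] us by simp
  qed
  have "?V \<noteq> {}" using TS by auto
  then obtain x where "x \<in> ?V" "x < Inf ?V + 1" using cInf_lessD[of ?V "Inf ?V + 1"] by auto
  then obtain t s where ts: "0 \<le> t" "t \<le> T" "0 \<le> s" and x: "?F t s < Inf ?V + 1" by auto
  have min: "?F t s \<le> ?F u v + 1" if "0 \<le> u" "u \<le> T" "0 \<le> v" for u v
  proof -
    have "Inf ?V \<le> ?F u v" using that by (intro cInf_lower[OF _ bdd]) blast
    with x show ?thesis by linarith
  qed
  define D where "D = mdist X (\<beta> t) (\<gamma> s)"
  have D0: "0 \<le> D" by (simp add: D_def)
  \<comment> \<open>Comparison with the given pair \<open>(T, S)\<close>. The gain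
    \<open>2 * D\<close> pays for the length, at most \<open>D + 1\<close>, of the bridge built
    next.\<close>
  have s_ge: "S - 2 * K - 2 + 2 * D \<le> s" using min[of T S] TS by (simp add: D_def)
  have far: "D + v / 2 - 1 \<le> mdist X (\<beta> u) (\<gamma> (s + v))" if "0 \<le> u" "u \<le> t" "0 \<le> v" for u v
    using min[of u "s + v"] that ts by (simp add: D_def add_divide_distrib)
  obtain l \<sigma> where l: "0 \<le> l" "l \<le> D + 1" and \<sigma>M: "\<And>v. v \<in> {0..l} \<Longrightarrow> \<sigma> v \<in> mspace X"
    and \<sigma>: "\<sigma> 0 = \<beta> t" "\<sigma> l = \<gamma> s"
    and \<sigma>L: "\<And>v w. v \<in> {0..l} \<Longrightarrow> w \<in> {0..l} \<Longrightarrow> mdist X (\<sigma> v) (\<sigma> w) \<le> \<bar>v - w\<bar>"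
    using length_spaceE[OF X M[OF ts(1)] gM[OF ts(3)] zero_less_one] unfolding D_def by metis
  \<comment> \<open>An almost shortest bridge from \<open>\<beta> t\<close> to
    \<open>\<gamma> s\<close>, followed by \<open>\<gamma>\<close>.\<close>
  define \<tau> where "\<tau> = (\<lambda>v. if v \<le> l then \<sigma> v else \<gamma> (s + (v - l)))"
  have \<tau>1: "\<tau> v = \<sigma> v" if "v \<le> l" for v using that by (simp add: \<tau>_def)
  have \<tau>2: "\<tau> v = \<gamma> (s + (v - l))" if "l \<le> v" for v using that \<sigma>(2) by (auto simp: \<tau>_def)
  have \<tau>M: "\<tau> v \<in> mspace X" if "0 \<le> v" for v
    using that \<sigma>M gM ts l by (auto simp: \<tau>_def)
  have \<tau>g: "mdist X (\<tau> v) (\<tau> w) = \<bar>v - w\<bar>" if "l \<le> v" "l \<le> w" for v w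
    using \<tau>2[OF that(1)] \<tau>2[OF that(2)] g[of "s + (v - l)" "s + (w - l)"] that ts by simp
  have \<tau>s: "mdist X (\<tau> v) (\<tau> w) \<le> \<bar>v - w\<bar>" if "v \<in> {0..l}" "w \<in> {0..l}" for v w
    using \<tau>1 \<sigma>L[OF that] that by simp
  have \<tau>L: "mdist X (\<tau> v) (\<tau> w) \<le> \<bar>v - w\<bar>" if "0 \<le> v" "0 \<le> w" for v w
  proof -
    have *: "mdist X (\<tau> v) (\<tau> w) \<le> \<bar>v - w\<bar>" if "0 \<le> v" "v \<le> w" for v w
    proof (cases "v \<le> l \<and> l \<le> w")
      case True
      have "mdist X (\<tau> v) (\<tau> w) \<le> mdist X (\<tau> v) (\<tau> l) + mdist X (\<tau> l) (\<tau> w)"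
        using that l by (intro mdist_triangle \<tau>M) auto
      then show ?thesis using \<tau>s[of v l] \<tau>g[of l w] True that l by simp
    next
      case False
      then show ?thesis using \<tau>s[of v w] \<tau>g[of v w] that by auto
    qed
    show ?thesis using *[of v w] *[of w v] that by (cases "v \<le> w") (auto simp: mdist_commute abs_minus_commute)
  qed
  \<comment> \<open>On the bridge, its end is at least \<open>D - 1\<close> from
    \<open>\<beta> u\<close> while its length is at most \<open>D + 1\<close>, so the loss is at
    most 2. Along \<open>\<gamma>\<close> the bound \<open>far\<close> grows at half speed, whence
    the factor 2.\<close>
  have lower2: "w \<le> 2 * mdist X (\<beta> u) (\<tau> w) + 4" if u: "0 \<le> u" "u \<le> t" "0 \<le> w" for u w
  proof (cases "w \<le> l")
    case True
    have "mdist X (\<beta> u) (\<tau> l) \<le> mdist X (\<beta> u) (\<tau> w) + mdist X (\<tau> w) (\<tau> l)"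
      using u l by (intro mdist_triangle M \<tau>M) auto
    moreover have "D - 1 \<le> mdist X (\<beta> u) (\<tau> l)" using far[OF u(1,2), of 0] \<tau>2[of l] by simp
    moreover have "mdist X (\<tau> w) (\<tau> l) \<le> l - w" using \<tau>L[of w l] u True l by simp
    ultimately show ?thesis using l True u mdist_nonneg[of X "\<beta> u" "\<tau> w"] by linarith
  next
    case False
    then show ?thesis using far[OF u(1,2), of "w - l"] \<tau>2[of w] l D0 by (simp add: field_simps)
  qed
  have lower1: "w - v \<le> 2 * mdist X (\<tau> v) (\<tau> w) + 4" if v: "0 \<le> v" "v \<le> w" for v w
  proof -
    consider "w \<le> l" | "v \<le> l" "l \<le> w" | "l \<le> v" by linarith
    then show ?thesis
    proof cases
      case 1
      have "mdist X (\<tau> 0) (\<tau> l) \<le> mdist X (\<tau> 0) (\<tau> v) + mdist X (\<tau> v) (\<tau> l)"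
        using v l by (intro mdist_triangle \<tau>M) auto
      moreover have "mdist X (\<tau> v) (\<tau> l) \<le> mdist X (\<tau> v) (\<tau> w) + mdist X (\<tau> w) (\<tau> l)"
        using v l by (intro mdist_triangle \<tau>M) auto
      moreover have "mdist X (\<tau> 0) (\<tau> l) = D" using \<tau>1[of 0] \<tau>1[of l] \<sigma> l by (simp add: D_def)
      moreover have "mdist X (\<tau> 0) (\<tau> v) \<le> v" "mdist X (\<tau> w) (\<tau> l) \<le> l - w"
        using \<tau>L[of 0 v] \<tau>L[of w l] v l 1 by auto
      ultimately show ?thesis using l v mdist_nonneg[of X "\<tau> v" "\<tau> w"] by linarith
    next
      case 2
      \<comment> \<open>Here \<open>far\<close> is applied at \<open>\<tau> 0 = \<beta> t\<close>,
        and the piece of the bridge up to \<open>v\<close> is subtracted.\<close>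
      have "mdist X (\<tau> 0) (\<tau> w) \<le> mdist X (\<tau> 0) (\<tau> v) + mdist X (\<tau> v) (\<tau> w)"
        using v l by (intro mdist_triangle \<tau>M) auto
      moreover have "D + (w - l) / 2 - 1 \<le> mdist X (\<tau> 0) (\<tau> w)"
        using far[OF ts(1) order_refl, of "w - l"] 2 \<tau>2[of w] \<tau>1[of 0] \<sigma>(1) l by simp
      moreover have "mdist X (\<tau> 0) (\<tau> v) \<le> v" using \<tau>L[of 0 v] v by auto
      ultimately have "(l - v) + (w - l) / 2 - 2 \<le> mdist X (\<tau> v) (\<tau> w)" using l by linarith
      then show ?thesis using 2 by (simp add: field_simps)
    next
      case 3
      then show ?thesis using \<tau>g[of v w] v by simp
    qed
  qed
  let ?\<delta> = "\<lambda>u\<in>{0..}. if u \<le> t then \<beta> u else \<tau> (u - t)"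
  have \<tau>0: "\<tau> 0 = \<beta> t" using \<tau>1[of 0] l \<sigma> by simp
  have far0: "S - 2 * K - 3 \<le> mdist X (\<gamma> 0) (\<tau> v)" if v: "0 \<le> v" for v
  proof (cases "v \<le> l")
    case True
    have "mdist X (\<gamma> 0) (\<tau> l) \<le> mdist X (\<gamma> 0) (\<tau> v) + mdist X (\<tau> v) (\<tau> l)"
      using v l by (intro mdist_triangle \<tau>M gM) auto
    moreover have "mdist X (\<gamma> 0) (\<tau> l) = s" using \<tau>2[of l] g[of 0 s] ts by simp
    moreover have "mdist X (\<tau> v) (\<tau> l) \<le> l - v" using \<tau>L[of v l] v l True by simp
    ultimately show ?thesis using s_ge l v D0 by linarith
  next
    case False
    then have "mdist X (\<gamma> 0) (\<tau> v) = s + (v - l)" using \<tau>2[of v] g[of 0 "s + (v - l)"] ts by simp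
    then show ?thesis using s_ge D0 False by linarith
  qed
  show ?thesis
  proof (rule that[of ?\<delta> t "t + l" s])
    show "cqg_ray X (5 * n + 5) (5 * n + 5) ?\<delta>"
      by (rule cqg_ray_splice[OF \<beta> n ts(1) \<tau>M \<tau>0 \<tau>L lower1 lower2])
    show "S - 2 * K - 3 \<le> mdist X (\<gamma> 0) (?\<delta> u)" if "t \<le> u" for u
    proof -
      have "?\<delta> u = \<tau> (u - t)" using that \<tau>0 ts by (cases "u = t") auto
      then show ?thesis using far0[of "u - t"] that by simp
    qed
    show "?\<delta> (t + l + u) = \<gamma> (s + u)" if "0 \<le> u" for u
    proof (cases "t + l + u \<le> t")
      case True
      then have "l = 0" "u = 0" using l that by auto
      then show ?thesis using \<tau>0 \<tau>2[of 0] ts by simp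
    next
      case False
      then show ?thesis using \<tau>2[of "l + u"] that l ts by simp
    qed
  qed (use ts l in auto)
qed

section \<open>Fellow-travelling neighbourhoods\<close>

text \<open>The set N(q, n, C) of the opening explanation.\<close>

definition passing_near :: "'a metric \<Rightarrow> 'a \<Rightarrow> 'a \<Rightarrow> real \<Rightarrow> real \<Rightarrow> (real \<Rightarrow> 'a) set set" where
  "passing_near X p q n C =
     {\<eta> \<in> contracting_boundary X p. \<forall>\<beta>\<in>\<eta>. cqg_ray X n n \<beta> \<longrightarrow> (\<exists>t\<ge>0. mdist X (\<beta> t) q \<le> C)}"

text \<open>Moves the centre to a nearby point of a countable coarsely dense set and back.\<close>

lemma passing_near_shift:
  assumes "q \<in> mspace X" "q' \<in> mspace X" "mdist X q q' \<le> e"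
  shows "passing_near X p q n C \<subseteq> passing_near X p q' n (C + e)"
proof -
  have "\<exists>t\<ge>0. mdist X (\<beta> t) q' \<le> C + e" if \<beta>: "cqg_ray X n n \<beta>" and t: "0 \<le> t" "mdist X (\<beta> t) q \<le> C" for \<beta> t
  proof -
    have "mdist X (\<beta> t) q' \<le> mdist X (\<beta> t) q + mdist X q q'"
      using cqg_rayD(1)[OF \<beta> t(1) t(1)] assms by (intro mdist_triangle)
    then show ?thesis using t assms(3) by (intro exI[of _ t]) simp
  qed
  then show ?thesis unfolding passing_near_def by blast
qed

locale fq_space =
  fixes X :: "'a metric" and p :: 'a and \<alpha> :: "(real \<Rightarrow> 'a) set \<Rightarrow> real \<Rightarrow> 'a"
  assumes length_space: "length_space X" and choice: "geodesic_choice X p \<alpha>"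
begin

abbreviation \<Delta> :: "(real \<Rightarrow> 'a) set set" where "\<Delta> \<equiv> contracting_boundary X p"

lemma chosen:
  assumes "\<zeta> \<in> \<Delta>"
  shows chosen_geodesic: "geodesic_ray X (\<alpha> \<zeta>)" and chosen_mem: "\<alpha> \<zeta> \<in> \<zeta>" and chosen_0: "\<alpha> \<zeta> 0 = p"
    and chosen_proximinal: "proximinal X (ray_image (\<alpha> \<zeta>))"
  using choice assms boundary_point_ray[OF assms] geodesic_ray_proximinal
  by (auto simp: geodesic_choice_def contracting_rays_def)

lemma boundary_start: "\<zeta> \<in> \<Delta> \<Longrightarrow> \<beta> \<in> \<zeta> \<Longrightarrow> \<beta> 0 = p"
  using boundary_point_ray by (fastforce simp: contracting_rays_def)

lemma chosen_proj_bound: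
  assumes "\<zeta> \<in> \<Delta>"
  obtains \<rho> where "sublinear \<rho>" "proj_bound X \<rho> (ray_image (\<alpha> \<zeta>))"
proof -
  have "contracting X (ray_image (\<alpha> \<zeta>))"
    using boundary_point_ray[OF assms chosen_mem[OF assms]] by (auto simp: contracting_rays_def)
  then show ?thesis
    using that rho_contracting_proj_bound[OF chosen_proximinal[OF assms]] unfolding contracting_def by blast
qed

text \<open>Membership in the class only gives some finite Hausdorff distance to
  \<open>\<alpha> \<zeta>\<close>; \<open>qg_returns\<close> improves it to the threshold
  \<open>K\<close> at arbitrarily late times.\<close>

lemma class_returns:
  assumes \<zeta>: "\<zeta> \<in> \<Delta>" and \<beta>: "\<beta> \<in> \<zeta>" "cqg_ray X L A \<beta>" and L: "1 \<le> L" and A: "0 \<le> A"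
    and \<rho>: "proj_bound X \<rho> (ray_image (\<alpha> \<zeta>))" and K: "qg_threshold \<rho> L A K"
  obtains t where "T \<le> t" "0 \<le> t" "point_dist X (\<beta> t) (ray_image (\<alpha> \<zeta>)) \<le> K"
proof -
  let ?Z = "ray_image (\<alpha> \<zeta>)"
  have "finite_hausdorff_dist X (ray_image \<beta>) ?Z"
    using boundary_finite_hausdorff_dist[OF \<zeta> \<beta>(1) chosen_mem[OF \<zeta>]] .
  then obtain D where D: "\<And>a. a \<in> ray_image \<beta> \<Longrightarrow> \<exists>b\<in>?Z. mdist X a b \<le> D"
    unfolding finite_hausdorff_dist_def by blast
  have "point_dist X (\<beta> t) ?Z \<le> D" if t: "0 \<le> t" for t
  proof -
    obtain b where "b \<in> ?Z" "mdist X (\<beta> t) b \<le> D" using D[of "\<beta> t"] t by auto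
    then show ?thesis using point_dist_le[of b ?Z X "\<beta> t"] by linarith
  qed
  moreover have "\<beta> 0 \<in> ?Z" using boundary_start[OF \<zeta> \<beta>(1)] chosen_0[OF \<zeta>] by (metis atLeast_iff image_eqI order_refl)
  ultimately show ?thesis
    using qg_returns[OF chosen_proximinal[OF \<zeta>] \<rho> \<beta>(2) L K A] that by blast
qed

text \<open>One function has to serve all geodesics of the class, since \<open>rho_of\<close> takes
  a supremum over them. This works because each of them is at Hausdorff distance at most
  \<open>42 * K\<close> from \<open>\<alpha> \<zeta>\<close>, where \<open>K\<close> depends on
  \<open>\<rho>\<close> only.\<close>

lemma geodesics_proj_bound:
  assumes \<zeta>: "\<zeta> \<in> \<Delta>"
  obtains \<sigma> where "sublinear \<sigma>" "\<And>\<delta>. \<delta> \<in> \<zeta> \<Longrightarrow> geodesic_ray X \<delta> \<Longrightarrow> proj_bound X \<sigma> (ray_image \<delta>)"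
proof -
  let ?Z = "ray_image (\<alpha> \<zeta>)"
  obtain \<rho> where \<rho>: "sublinear \<rho>" "proj_bound X \<rho> ?Z" using chosen_proj_bound[OF \<zeta>] .
  define K where "K = kappa \<rho> 1 0"
  have K: "qg_threshold \<rho> 1 0 K" unfolding K_def using sublinear_threshold[OF \<rho>(1)] by simp
  have K0: "3 \<le> K" using qg_thresholdD(3)[OF K _ order_refl] by simp
  \<comment> \<open>For \<open>L = 1\<close> and \<open>A = 0\<close> the excursion bound is
    \<open>K + 20 * K = 21 * K\<close>, and tracking doubles it.\<close>
  let ?C = "42 * K"
  show ?thesis
  proof (rule that)
    show "sublinear (\<lambda>r. 4 * max 0 (\<rho> (2 * r + 3 * ?C)) + (16 * ?C + 12))"
      using K0 by (intro sublinear_hausdorff[OF \<rho>(1)]) auto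
    fix \<delta> assume \<delta>: "\<delta> \<in> \<zeta>" "geodesic_ray X \<delta>"
    note cqg = geodesic_ray_cqg[OF \<delta>(2)]
    have start: "\<delta> 0 = \<alpha> \<zeta> 0" using boundary_start[OF \<zeta> \<delta>(1)] chosen_0[OF \<zeta>] by simp
    have ret: "\<exists>t. T \<le> t \<and> 0 \<le> t \<and> point_dist X (\<delta> t) ?Z \<le> K" for T
      using class_returns[OF \<zeta> \<delta>(1) cqg _ _ \<rho>(2) K] by (metis order_refl)
    show "proj_bound X (\<lambda>r. 4 * max 0 (\<rho> (2 * r + 3 * ?C)) + (16 * ?C + 12)) (ray_image \<delta>)"
    proof (rule proj_bound_hausdorff[OF length_space chosen_proximinal[OF \<zeta>] \<rho>(2)])
      show "mono_on {0..} \<rho>" using \<rho>(1) by (simp add: sublinear_def)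
      show "ray_image \<delta> \<subseteq> mspace X" using cqg_rayD(1)[OF cqg] by auto
      show "0 \<le> ?C" using K0 by simp
      show "point_dist X z ?Z \<le> ?C" if "z \<in> ray_image \<delta>" for z
      proof -
        from that obtain u where u: "0 \<le> u" "z = \<delta> u" by auto
        obtain t where t: "u \<le> t" "point_dist X (\<delta> t) ?Z \<le> K" using ret by blast
        have "\<delta> 0 \<in> ?Z" using start by (metis atLeast_iff image_eqI order_refl)
        then have "point_dist X (\<delta> 0) ?Z \<le> mdist X (\<delta> 0) (\<delta> 0)" by (rule point_dist_le)
        also have "\<dots> = 0" using cqg_rayD(1)[OF cqg, of 0 0] by simp
        finally have "point_dist X (\<delta> 0) ?Z \<le> K" using K0 by simp
        then show ?thesis
          using qg_excursion_bound[OF chosen_proximinal[OF \<zeta>] \<rho>(2) cqg _ K _ order_refl u(1) t(1) _ t(2)] u K0 by simp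
      qed
      show "\<exists>z'\<in>ray_image \<delta>. mdist X z z' \<le> ?C" if "z \<in> ?Z" for z
      proof -
        from that obtain s where s: "0 \<le> s" "z = \<alpha> \<zeta> s" by auto
        obtain t where t: "s \<le> t" "0 \<le> t" "point_dist X (\<delta> t) ?Z \<le> K" using ret by blast
        have "s \<le> mdist X (\<alpha> \<zeta> 0) (\<delta> t)" using \<delta>(2) t start unfolding geodesic_ray_def by (metis abs_of_nonneg abs_minus_commute diff_zero order_refl)
        then obtain u where "0 \<le> u" "mdist X (\<delta> u) (\<alpha> \<zeta> s) \<le> 2 * (K + 0 + 5 * 1\<^sup>2 * (0 + 4 * K))"
          using qg_tracks_geodesic[OF chosen_geodesic[OF \<zeta>] \<rho>(2) cqg _ K _ start t(2,3) s(1)] by auto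
        then show ?thesis using s by (intro bexI[of _ "\<delta> u"]) (auto simp: mdist_commute)
      qed
    qed
  qed
qed

text \<open>Everything rests on the uniform \<open>\<sigma>\<close>: it bounds the set in
  \<open>rho_of\<close> above, so that the supremum is meaningful, and it forces
  \<open>rho_of X \<zeta> r \<le> 2 * \<sigma> r\<close>.\<close>

lemma rho_of_facts:
  assumes \<zeta>: "\<zeta> \<in> \<Delta>"
  shows rho_of_proj_bound: "proj_bound X (rho_of X \<zeta>) (ray_image (\<alpha> \<zeta>))"
    and rho_of_threshold: "1 \<le> L \<Longrightarrow> qg_threshold (rho_of X \<zeta>) L A (kappa (rho_of X \<zeta>) L A)"
proof -
  obtain \<sigma> where \<sigma>: "sublinear \<sigma>" "\<And>\<delta>. \<delta> \<in> \<zeta> \<Longrightarrow> geodesic_ray X \<delta> \<Longrightarrow> proj_bound X \<sigma> (ray_image \<delta>)"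
    by (rule geodesics_proj_bound[OF \<zeta>]) (rule that)
  have mono: "mono_on {0..} \<sigma>" using \<sigma>(1) by (simp add: sublinear_def)
  let ?D = "\<lambda>r. {diam X (proj X (ray_image \<alpha>) x \<union> proj X (ray_image \<alpha>) y) | \<alpha> x y.
            \<alpha> \<in> \<zeta> \<and> geodesic_ray X \<alpha> \<and> x \<in> mspace X \<and> y \<in> mspace X \<and>
            mdist X x y \<le> point_dist X x (ray_image \<alpha>) \<and> point_dist X x (ray_image \<alpha>) \<le> r}"
  have le: "d \<le> 2 * \<sigma> r" if "d \<in> ?D r" for d r
  proof -
    from that obtain \<delta> x y where d: "d = diam X (proj X (ray_image \<delta>) x \<union> proj X (ray_image \<delta>) y)"
      and \<delta>: "\<delta> \<in> \<zeta>" "geodesic_ray X \<delta>" and xy: "x \<in> mspace X" "y \<in> mspace X"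
        "mdist X x y \<le> point_dist X x (ray_image \<delta>)" and r: "point_dist X x (ray_image \<delta>) \<le> r"
      by blast
    note prox = geodesic_ray_proximinal[OF \<delta>(2)]
    have "d \<le> 2 * \<sigma> (point_dist X x (ray_image \<delta>))"
      unfolding d using diam_proj_le[OF prox \<sigma>(2)[OF \<delta>] xy] .
    moreover have "\<sigma> (point_dist X x (ray_image \<delta>)) \<le> \<sigma> r"
      using mono_onD[OF mono, of "point_dist X x (ray_image \<delta>)" r] point_dist_nonneg[OF prox xy(1)] r by simp
    ultimately show ?thesis by linarith
  qed
  have upper: "d \<le> rho_of X \<zeta> r" if "d \<in> ?D r" for d r
    unfolding rho_of_def by (rule cSup_upper[OF that]) (rule bdd_aboveI, rule le)
  \<comment> \<open>The basepoint lies on the ray and witnesses nonemptiness for every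
    \<open>r \<ge> 0\<close>, which is what lets the supremum be bounded from above.\<close>
  have "?D r \<noteq> {}" if "0 \<le> r" for r
  proof -
    have p: "p \<in> mspace X" using cqg_rayD(1)[OF geodesic_ray_cqg[OF chosen_geodesic[OF \<zeta>]], of 0 0] chosen_0[OF \<zeta>] by simp
    have "p \<in> ray_image (\<alpha> \<zeta>)" using chosen_0[OF \<zeta>] by (metis atLeast_iff image_eqI order_refl)
    then have "point_dist X p (ray_image (\<alpha> \<zeta>)) \<le> mdist X p p" by (rule point_dist_le)
    moreover have "mdist X p p = 0" using p by simp
    moreover have "0 \<le> point_dist X p (ray_image (\<alpha> \<zeta>))" using point_dist_nonneg[OF chosen_proximinal[OF \<zeta>] p] .
    ultimately have "mdist X p p \<le> point_dist X p (ray_image (\<alpha> \<zeta>)) \<and> point_dist X p (ray_image (\<alpha> \<zeta>)) \<le> r"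
      using that by linarith
    then show ?thesis using p chosen_mem[OF \<zeta>] chosen_geodesic[OF \<zeta>] by blast
  qed
  then have "rho_of X \<zeta> r \<le> 2 * \<sigma> r" if "0 \<le> r" for r
    unfolding rho_of_def using le that by (intro cSup_least) auto
  moreover have "sublinear (\<lambda>r. 2 * \<sigma> r)" using sublinear_cmult[OF \<sigma>(1)] by simp
  ultimately show "qg_threshold (rho_of X \<zeta>) L A (kappa (rho_of X \<zeta>) L A)" if "1 \<le> L"
    using sublinear_threshold that by blast
  show "proj_bound X (rho_of X \<zeta>) (ray_image (\<alpha> \<zeta>))"
    unfolding proj_bound_def
  proof (intro ballI impI)
    fix x y a b
    assume xy: "x \<in> mspace X" "y \<in> mspace X" "mdist X x y \<le> point_dist X x (ray_image (\<alpha> \<zeta>))"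
      and ab: "a \<in> proj X (ray_image (\<alpha> \<zeta>)) x" "b \<in> proj X (ray_image (\<alpha> \<zeta>)) y"
    have "mdist X a b \<le> diam X (proj X (ray_image (\<alpha> \<zeta>)) x \<union> proj X (ray_image (\<alpha> \<zeta>)) y)"
      using mdist_le_diam_proj[OF chosen_proximinal[OF \<zeta>] xy(1,2)] ab by blast
    also have "\<dots> \<le> rho_of X \<zeta> (point_dist X x (ray_image (\<alpha> \<zeta>)))"
      using xy chosen_mem[OF \<zeta>] chosen_geodesic[OF \<zeta>] by (intro upper) blast
    finally show "mdist X a b \<le> rho_of X \<zeta> (point_dist X x (ray_image (\<alpha> \<zeta>)))" .
  qed
qed

section \<open>Comparing the neighbourhoods of a boundary point\<close>

lemma fq_nbhd_iff:
  "\<eta> \<in> fq_nbhd X p \<alpha> \<zeta> r \<longleftrightarrow> \<eta> \<in> \<Delta> \<and> (\<forall>L\<ge>1. \<forall>A\<ge>0. \<forall>\<beta>\<in>\<eta>. cqg_ray X L A \<beta> \<longrightarrow>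
     set_dist X (ray_image \<beta>) {x \<in> ray_image (\<alpha> \<zeta>). r \<le> mdist X x p} \<le> kappa (rho_of X \<zeta>) L A)"
  by (auto simp: fq_nbhd_def cqg_ray_def)

lemma chosen_dist:
  assumes "\<zeta> \<in> \<Delta>" "0 \<le> s" "0 \<le> t"
  shows "\<alpha> \<zeta> s \<in> mspace X" "mdist X (\<alpha> \<zeta> s) (\<alpha> \<zeta> t) = \<bar>s - t\<bar>" "mdist X (\<alpha> \<zeta> s) p = s"
proof -
  have g: "\<forall>s\<ge>0. \<forall>t\<ge>0. mdist X (\<alpha> \<zeta> s) (\<alpha> \<zeta> t) = \<bar>s - t\<bar>" "\<alpha> \<zeta> \<in> {0..} \<rightarrow>\<^sub>E mspace X"
    using chosen_geodesic[OF assms(1)] by (auto simp: geodesic_ray_def)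
  show "\<alpha> \<zeta> s \<in> mspace X" using g(2) assms by (auto simp: PiE_iff)
  show "mdist X (\<alpha> \<zeta> s) (\<alpha> \<zeta> t) = \<bar>s - t\<bar>" using g(1) assms by simp
  have "mdist X (\<alpha> \<zeta> s) (\<alpha> \<zeta> 0) = \<bar>s - 0\<bar>" using g(1) assms by blast
  then show "mdist X (\<alpha> \<zeta> s) p = s" using chosen_0[OF assms(1)] assms by simp
qed

text \<open>Returns to the \<open>K\<close>-neighbourhood of \<open>\<alpha> \<zeta>\<close> happen
  arbitrarily late, hence arbitrarily far from \<open>p\<close>, so that nearest points on
  \<open>\<alpha> \<zeta>\<close> lie in the tail.\<close>

lemma mem_fq_nbhd:
  assumes \<zeta>: "\<zeta> \<in> \<Delta>"
  shows "\<zeta> \<in> fq_nbhd X p \<alpha> \<zeta> r"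
  unfolding fq_nbhd_iff
proof (intro conjI allI ballI impI)
  fix L A :: real and \<beta> assume L: "1 \<le> L" and A: "0 \<le> A" and \<beta>: "\<beta> \<in> \<zeta>" "cqg_ray X L A \<beta>"
  let ?Z = "ray_image (\<alpha> \<zeta>)"
  define K where "K = kappa (rho_of X \<zeta>) L A"
  have K: "qg_threshold (rho_of X \<zeta>) L A K" using rho_of_threshold[OF \<zeta> L] by (simp add: K_def)
  \<comment> \<open>At such a time \<open>\<beta> t\<close> is at least \<open>max r 0 + K\<close>
    away from \<open>p\<close>; passing to the nearest point on the ray costs \<open>K\<close> and
    leaves \<open>r\<close>.\<close>
  obtain t where t: "L * (max r 0 + A + K) \<le> t" "0 \<le> t" "point_dist X (\<beta> t) ?Z \<le> K"
    using class_returns[OF \<zeta> \<beta> L A rho_of_proj_bound[OF \<zeta>] K] .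
  have M: "\<beta> t \<in> mspace X" using cqg_rayD(1)[OF \<beta>(2) t(2) t(2)] .
  obtain z where "z \<in> proj X ?Z (\<beta> t)" using proximinal_projE[OF chosen_proximinal[OF \<zeta>] M] .
  then obtain s where s: "0 \<le> s" "mdist X (\<beta> t) (\<alpha> \<zeta> s) \<le> K" using t(3) by (auto dest: projD)
  have "max r 0 + A + K \<le> t / L" using t(1) L by (simp add: pos_le_divide_eq mult.commute)
  moreover have "t / L - A \<le> mdist X (\<beta> t) p"
    using cqg_rayD(2)[OF \<beta>(2), of t 0] t boundary_start[OF \<zeta> \<beta>(1)] by simp
  moreover have "mdist X (\<beta> t) p \<le> mdist X (\<beta> t) (\<alpha> \<zeta> s) + mdist X (\<alpha> \<zeta> s) p"
    using M chosen_dist(1)[OF \<zeta>, of s s] chosen_dist(1)[OF \<zeta>, of 0 0] chosen_0[OF \<zeta>] s by (intro mdist_triangle) auto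
  ultimately have "r \<le> mdist X (\<alpha> \<zeta> s) p" using s by linarith
  then have "set_dist X (ray_image \<beta>) {x \<in> ?Z. r \<le> mdist X x p} \<le> mdist X (\<beta> t) (\<alpha> \<zeta> s)"
    using s t by (intro set_dist_le) auto
  then show "set_dist X (ray_image \<beta>) {x \<in> ?Z. r \<le> mdist X x p} \<le> kappa (rho_of X \<zeta>) L A"
    using s by (simp add: K_def)
qed (rule \<zeta>)

text \<open>\<open>set_dist\<close> is an infimum, so actual points come with slack 1. The tail has
  to be nonempty for this; \<open>max 0 r\<close> provides a point of it.\<close>

lemma fq_nbhdE:
  assumes \<zeta>: "\<zeta> \<in> \<Delta>" and \<eta>: "\<eta> \<in> fq_nbhd X p \<alpha> \<zeta> r" "\<beta> \<in> \<eta>" "cqg_ray X L A \<beta>" "1 \<le> L" "0 \<le> A"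
  obtains t s where "0 \<le> t" "0 \<le> s" "r \<le> s" "mdist X (\<beta> t) (\<alpha> \<zeta> s) \<le> kappa (rho_of X \<zeta>) L A + 1"
proof -
  let ?T = "{x \<in> ray_image (\<alpha> \<zeta>). r \<le> mdist X x p}" and ?K = "kappa (rho_of X \<zeta>) L A"
  have "set_dist X (ray_image \<beta>) ?T \<le> ?K" using \<eta> unfolding fq_nbhd_iff by blast
  then have "Inf {mdist X a b |a b. a \<in> ray_image \<beta> \<and> b \<in> ?T} < ?K + 1" unfolding set_dist_def by linarith
  moreover have "\<alpha> \<zeta> (max 0 r) \<in> ?T" using chosen_dist(3)[OF \<zeta>, of "max 0 r" 0] by auto
  then have "{mdist X a b |a b. a \<in> ray_image \<beta> \<and> b \<in> ?T} \<noteq> {}" by blast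
  ultimately obtain d where "d \<in> {mdist X a b |a b. a \<in> ray_image \<beta> \<and> b \<in> ?T}" "d < ?K + 1"
    by (metis (no_types, lifting) cInf_lessD)
  then obtain t s where ts: "0 \<le> t" "0 \<le> s" "r \<le> mdist X (\<alpha> \<zeta> s) p" "mdist X (\<beta> t) (\<alpha> \<zeta> s) < ?K + 1"
    by auto
  then show ?thesis using that[of t s] chosen_dist(3)[OF \<zeta>, of s 0] by simp
qed

text \<open>A ray that comes near \<open>\<alpha> \<zeta>\<close> beyond distance \<open>R\<close>
  from \<open>p\<close> passes near \<open>\<alpha> \<zeta> R\<close>, by
  \<open>qg_tracks_geodesic\<close>. The bound \<open>C0\<close> is fixed before \<open>R\<close>,
  because \<open>R\<close> is later chosen depending on \<open>C\<close>.\<close>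

lemma fq_nbhd_subset_passing_near:
  assumes \<zeta>: "\<zeta> \<in> \<Delta>" and n: "1 \<le> n"
  obtains C0 where "\<And>C R. C0 \<le> C \<Longrightarrow> 0 \<le> R \<Longrightarrow> \<exists>r\<ge>1. fq_nbhd X p \<alpha> \<zeta> r \<subseteq> passing_near X p (\<alpha> \<zeta> R) n C"
proof -
  define K where "K = kappa (rho_of X \<zeta>) n n + 1"
  have K: "qg_threshold (rho_of X \<zeta>) n n K"
    unfolding K_def by (rule qg_threshold_mono[OF rho_of_threshold[OF \<zeta> n]]) simp
  have n0: "0 \<le> n" using n by simp
  show ?thesis
  proof (rule that)
    fix C R :: real assume C: "2 * (K + n + 5 * n\<^sup>2 * (n + 4 * K)) \<le> C" and R: "0 \<le> R"
    \<comment> \<open>The extra \<open>K\<close> in the radius keeps \<open>\<beta> t\<close>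
      itself, not only its neighbour on \<open>\<alpha> \<zeta>\<close>, at distance at least
      \<open>R\<close> from \<open>p\<close>.\<close>
    have "\<exists>u\<ge>0. mdist X (\<beta> u) (\<alpha> \<zeta> R) \<le> C"
      if \<eta>: "\<eta> \<in> fq_nbhd X p \<alpha> \<zeta> (max 1 (R + K))" and \<beta>: "\<beta> \<in> \<eta>" "cqg_ray X n n \<beta>" for \<eta> \<beta>
    proof -
      obtain t s where ts: "0 \<le> t" "0 \<le> s" "max 1 (R + K) \<le> s" "mdist X (\<beta> t) (\<alpha> \<zeta> s) \<le> K"
        using fq_nbhdE[OF \<zeta> \<eta> \<beta> n n0] unfolding K_def .
      have M: "\<beta> t \<in> mspace X" using cqg_rayD(1)[OF \<beta>(2) ts(1) ts(1)] .
      have "\<eta> \<in> \<Delta>" using \<eta> by (simp add: fq_nbhd_def)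
      then have start: "\<beta> 0 = \<alpha> \<zeta> 0" using boundary_start \<beta>(1) chosen_0[OF \<zeta>] by simp
      have pd: "point_dist X (\<beta> t) (ray_image (\<alpha> \<zeta>)) \<le> K"
        using point_dist_le[of "\<alpha> \<zeta> s" "ray_image (\<alpha> \<zeta>)" X "\<beta> t"] ts by auto
      have "mdist X (\<alpha> \<zeta> 0) (\<alpha> \<zeta> s) \<le> mdist X (\<alpha> \<zeta> 0) (\<beta> t) + mdist X (\<beta> t) (\<alpha> \<zeta> s)"
        using M chosen_dist(1)[OF \<zeta>] ts by (intro mdist_triangle) auto
      then have "R \<le> mdist X (\<alpha> \<zeta> 0) (\<beta> t)" using chosen_dist(2)[OF \<zeta>, of 0 s] ts by simp
      then obtain u where "0 \<le> u" "mdist X (\<beta> u) (\<alpha> \<zeta> R) \<le> 2 * (K + n + 5 * n\<^sup>2 * (n + 4 * K))"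
        using qg_tracks_geodesic[OF chosen_geodesic[OF \<zeta>] rho_of_proj_bound[OF \<zeta>] \<beta>(2) n K n0 start ts(1) pd R]
        by blast
      then show ?thesis using C by (intro exI[of _ u]) simp
    qed
    then have "fq_nbhd X p \<alpha> \<zeta> (max 1 (R + K)) \<subseteq> passing_near X p (\<alpha> \<zeta> R) n C"
      unfolding passing_near_def by (auto simp: fq_nbhd_def)
    then show "\<exists>r\<ge>1. fq_nbhd X p \<alpha> \<zeta> r \<subseteq> passing_near X p (\<alpha> \<zeta> R) n C"
      by (intro exI[of _ "max 1 (R + K)"]) simp
  qed
qed

text \<open>Quasi-geodesics with \<open>kappa\<close> above \<open>n\<close> satisfy the condition
  already at their start. For the others \<open>L\<close> and \<open>A\<close> are at most
  \<open>n\<close>, so \<open>passing_near\<close> applies to them, and \<open>qg_hits_tail\<close>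
  restores the exact constant \<open>kappa\<close>.\<close>

lemma passing_near_subset_fq_nbhd:
  assumes \<zeta>: "\<zeta> \<in> \<Delta>" and n: "1 \<le> n"
  obtains R where "0 \<le> R" "passing_near X p (\<alpha> \<zeta> R) n C \<subseteq> fq_nbhd X p \<alpha> \<zeta> n"
proof
  let ?R = "max 0 (n + 2 * n + C + 5 * n\<^sup>2 * (2 * n + 3 * C))"
  show "0 \<le> ?R" by simp
  show "passing_near X p (\<alpha> \<zeta> ?R) n C \<subseteq> fq_nbhd X p \<alpha> \<zeta> n"
  proof
    fix \<eta> assume \<eta>: "\<eta> \<in> passing_near X p (\<alpha> \<zeta> ?R) n C"
    then have \<eta>\<Delta>: "\<eta> \<in> \<Delta>" by (simp add: passing_near_def)
    show "\<eta> \<in> fq_nbhd X p \<alpha> \<zeta> n"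
      unfolding fq_nbhd_iff
    proof (intro conjI allI ballI impI \<eta>\<Delta>)
      fix L A :: real and \<beta> assume L: "1 \<le> L" and A: "0 \<le> A" and \<beta>: "\<beta> \<in> \<eta>" "cqg_ray X L A \<beta>"
      define K where "K = kappa (rho_of X \<zeta>) L A"
      have K: "qg_threshold (rho_of X \<zeta>) L A K" using rho_of_threshold[OF \<zeta> L] by (simp add: K_def)
      have start: "\<beta> 0 = \<alpha> \<zeta> 0" using boundary_start[OF \<eta>\<Delta> \<beta>(1)] chosen_0[OF \<zeta>] by simp
      let ?T = "{x \<in> ray_image (\<alpha> \<zeta>). n \<le> mdist X x p}"
      have "set_dist X (ray_image \<beta>) ?T \<le> K"
      proof (cases "K \<le> n")
        case True
        have "L \<le> L\<^sup>2" using L by (simp add: power2_eq_square)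
        then have Ln: "L \<le> n" "A \<le> n" using qg_thresholdD[OF K L order_refl] True A L by linarith+
        then have "cqg_ray X n n \<beta>" using cqg_ray_mono[OF \<beta>(2) L] by blast
        then obtain t where "0 \<le> t" "mdist X (\<beta> t) (\<alpha> \<zeta> ?R) \<le> C"
          using \<eta> \<beta>(1) unfolding passing_near_def by blast
        from qg_hits_tail[OF chosen_geodesic[OF \<zeta>] rho_of_proj_bound[OF \<zeta>] \<beta>(2) L K A start Ln True this, of n]
        show ?thesis using chosen_0[OF \<zeta>] by simp
      next
        case False
        have "set_dist X (ray_image \<beta>) ?T \<le> mdist X (\<beta> 0) (\<alpha> \<zeta> n)"
          using chosen_dist(3)[OF \<zeta>, of n 0] n by (intro set_dist_le) auto
        also have "\<dots> = n" using start chosen_dist(2)[OF \<zeta>, of 0 n] n by simp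
        finally show ?thesis using False by simp
      qed
      then show "set_dist X (ray_image \<beta>) ?T \<le> kappa (rho_of X \<zeta>) L A" by (simp add: K_def)
    qed
  qed
qed

text \<open>The redirected ray \<open>\<delta>\<close> belongs to \<open>\<eta>\<close>, so it meets
  the ball of radius \<open>C\<close> about \<open>q\<close>. After the switch it avoids that ball
  by the choice of \<open>r\<close>, so the meeting point lies on \<open>\<beta>\<close>.\<close>

lemma fq_nbhd_of_passing_near:
  assumes \<eta>: "\<eta> \<in> passing_near X p q (5 * n + 5) C" and n: "1 \<le> n" and q: "q \<in> mspace X"
  obtains r where "1 \<le> r" "fq_nbhd X p \<alpha> \<eta> r \<subseteq> passing_near X p q n C"
proof
  have \<eta>\<Delta>: "\<eta> \<in> \<Delta>" using \<eta> by (simp add: passing_near_def)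
  have n0: "0 \<le> n" using n by simp
  let ?\<gamma> = "\<alpha> \<eta>"
  define K where "K = kappa (rho_of X \<eta>) n n + 1"
  \<comment> \<open>From the switch on, \<open>\<delta>\<close> is at least
    \<open>r - 2 * K - 3\<close> away from \<open>p\<close>, and this has to exceed
    \<open>mdist X p q + C\<close>; the 4 in place of 3 makes it strict.\<close>
  define r where "r = max 1 (mdist X p q + C + 2 * K + 4)"
  show "1 \<le> r" by (simp add: r_def)
  have pM: "p \<in> mspace X" using chosen_dist(1)[OF \<eta>\<Delta>, of 0 0] chosen_0[OF \<eta>\<Delta>] by simp
  show "fq_nbhd X p \<alpha> \<eta> r \<subseteq> passing_near X p q n C"
  proof
    fix \<theta> assume \<theta>: "\<theta> \<in> fq_nbhd X p \<alpha> \<eta> r"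
    then have \<theta>\<Delta>: "\<theta> \<in> \<Delta>" by (simp add: fq_nbhd_def)
    have "\<exists>t\<ge>0. mdist X (\<beta> t) q \<le> C" if \<beta>: "\<beta> \<in> \<theta>" "cqg_ray X n n \<beta>" for \<beta>
    proof -
      obtain T S where TS: "0 \<le> T" "0 \<le> S" "r \<le> S" "mdist X (\<beta> T) (?\<gamma> S) \<le> K"
        using fq_nbhdE[OF \<eta>\<Delta> \<theta> \<beta> n n0] unfolding K_def .
      have start: "\<beta> 0 = ?\<gamma> 0" using boundary_start[OF \<theta>\<Delta> \<beta>(1)] chosen_0[OF \<eta>\<Delta>] by simp
      obtain \<delta> t T' S' where \<delta>: "cqg_ray X (5 * n + 5) (5 * n + 5) \<delta>"
        and t: "0 \<le> t" "\<And>u. 0 \<le> u \<Longrightarrow> u \<le> t \<Longrightarrow> \<delta> u = \<beta> u"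
          "\<And>u. t \<le> u \<Longrightarrow> S - 2 * K - 3 \<le> mdist X (?\<gamma> 0) (\<delta> u)"
        and T': "0 \<le> T'" "0 \<le> S'" "\<And>u. 0 \<le> u \<Longrightarrow> \<delta> (T' + u) = ?\<gamma> (S' + u)"
        by (rule cqg_ray_redirect[OF length_space \<beta>(2) n chosen_geodesic[OF \<eta>\<Delta>] start TS(1,2,4)]) (rule that)
      let ?L = "5 * n + 5"
      have \<delta>M: "\<delta> u \<in> mspace X" if "0 \<le> u" for u using cqg_rayD(1)[OF \<delta> that that] .
      have \<delta>0: "\<delta> 0 = p" using t(1,2) start chosen_0[OF \<eta>\<Delta>] by simp
      \<comment> \<open>Past their initial pieces \<open>\<delta>\<close> and
        \<open>?\<gamma>\<close> coincide, and the initial pieces lie within \<open>B\<close> of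
        \<open>p\<close>. Any finite value makes \<open>\<delta>\<close> contracting and equivalent
        to \<open>?\<gamma>\<close>.\<close>
      define B where "B = max (?L * T' + ?L) S'"
      have B: "0 \<le> B" using T' by (simp add: B_def)
      have 1: "\<exists>b\<in>ray_image ?\<gamma>. mdist X a b \<le> B" if "a \<in> ray_image \<delta>" for a
      proof -
        from that obtain u where u: "0 \<le> u" "a = \<delta> u" by auto
        show ?thesis
        proof (cases "u \<le> T'")
          case True
          have "mdist X (\<delta> u) (\<delta> 0) \<le> ?L * u + ?L" using cqg_rayD(3)[OF \<delta>, of u 0] u by simp
          also have "\<dots> \<le> ?L * T' + ?L" using True n by (intro add_right_mono mult_left_mono) auto
          finally have "mdist X a (?\<gamma> 0) \<le> B" using u \<delta>0 chosen_0[OF \<eta>\<Delta>] by (simp add: B_def)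
          then show ?thesis by (intro bexI[of _ "?\<gamma> 0"]) auto
        next
          case False
          then have a: "a = ?\<gamma> (S' + (u - T'))" using T'(3)[of "u - T'"] u by simp
          moreover have "mdist X a a = 0" using \<delta>M u by simp
          ultimately show ?thesis using B False T' by (intro bexI[of _ a]) auto
        qed
      qed
      have 2: "\<exists>a\<in>ray_image \<delta>. mdist X a b \<le> B" if "b \<in> ray_image ?\<gamma>" for b
      proof -
        from that obtain s where s: "0 \<le> s" "b = ?\<gamma> s" by auto
        show ?thesis
        proof (cases "s \<le> S'")
          case True
          then have "mdist X (\<delta> 0) b \<le> B"
            using \<delta>0 s chosen_dist(3)[OF \<eta>\<Delta>, of s 0] by (simp add: B_def mdist_commute)
          then show ?thesis by (intro bexI[of _ "\<delta> 0"]) auto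
        next
          case False
          then have b: "b = \<delta> (T' + (s - S'))" using T'(3)[of "s - S'"] s by simp
          moreover have "mdist X b b = 0" using chosen_dist(1)[OF \<eta>\<Delta>, of s s] s by simp
          moreover have "b \<in> ray_image \<delta>" using b False T'(1) by (intro image_eqI[of _ _ "T' + (s - S')"]) auto
          ultimately show ?thesis using B by (intro bexI[of _ b]) auto
        qed
      qed
      obtain \<rho> where \<rho>: "sublinear \<rho>" "proj_bound X \<rho> (ray_image ?\<gamma>)" using chosen_proj_bound[OF \<eta>\<Delta>] .
      have "proj_bound X (\<lambda>r. 4 * max 0 (\<rho> (2 * r + 3 * B)) + (16 * B + 12)) (ray_image \<delta>)"
      proof (rule proj_bound_hausdorff[OF length_space chosen_proximinal[OF \<eta>\<Delta>] \<rho>(2) _ _ B])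
        show "mono_on {0..} \<rho>" using \<rho>(1) by (simp add: sublinear_def)
        show "ray_image \<delta> \<subseteq> mspace X" using \<delta>M by auto
        show "point_dist X z (ray_image ?\<gamma>) \<le> B" if z: "z \<in> ray_image \<delta>" for z
        proof -
          obtain b where "b \<in> ray_image ?\<gamma>" "mdist X z b \<le> B" using 1[OF z] by blast
          then show ?thesis using point_dist_le[of b "ray_image ?\<gamma>" X z] by linarith
        qed
        show "\<exists>z'\<in>ray_image \<delta>. mdist X z z' \<le> B" if "z \<in> ray_image ?\<gamma>" for z
          using 2[OF that] by (simp add: mdist_commute)
      qed
      then have "contracting X (ray_image \<delta>)"
        using contractingI[OF cqg_ray_proximinal[OF \<delta>] _ sublinear_hausdorff[OF \<rho>(1) B]] n B by simp
      then have "\<delta> \<in> contracting_rays X p"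
        using \<delta> \<delta>0 n unfolding contracting_rays_def cqg_ray_def by (auto intro!: exI[of _ ?L])
      moreover have "finite_hausdorff_dist X (ray_image ?\<gamma>) (ray_image \<delta>)"
        by (rule finite_hausdorff_dist_sym) (use 1 2 in \<open>unfold finite_hausdorff_dist_def, blast\<close>)
      ultimately have "\<delta> \<in> \<eta>" by (rule boundary_memI[OF \<eta>\<Delta> chosen_mem[OF \<eta>\<Delta>]])
      then obtain u where u: "0 \<le> u" "mdist X (\<delta> u) q \<le> C"
        using \<eta> \<delta> unfolding passing_near_def by blast
      have "u \<le> t"
      proof (rule ccontr)
        assume "\<not> u \<le> t"
        then have "S - 2 * K - 3 \<le> mdist X p (\<delta> u)" using t(3)[of u] chosen_0[OF \<eta>\<Delta>] by simp
        also have "\<dots> \<le> mdist X p q + mdist X q (\<delta> u)" using pM q \<delta>M u by (intro mdist_triangle) auto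
        finally show False using u TS(3) by (simp add: r_def mdist_commute)
      qed
      then show ?thesis using u t(2)[of u] by auto
    qed
    then show "\<theta> \<in> passing_near X p q n C" using \<theta>\<Delta> by (simp add: passing_near_def)
  qed
qed

section \<open>Interiors and the countable base\<close>

definition near_interior :: "'a \<Rightarrow> real \<Rightarrow> real \<Rightarrow> (real \<Rightarrow> 'a) set set" where
  "near_interior q n C = {\<eta> \<in> \<Delta>. \<exists>r\<ge>1. fq_nbhd X p \<alpha> \<eta> r \<subseteq> passing_near X p q n C}"

lemma near_interior_subset: "near_interior q n C \<subseteq> passing_near X p q n C"
  using mem_fq_nbhd by (auto simp: near_interior_def)

text \<open>About a point of \<open>\<alpha> \<zeta>\<close> far enough out, the set N with constant
  \<open>5 * r + 5\<close> contains a \<open>fq_nbhd\<close> of \<open>\<zeta>\<close>, while the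
  one with constant \<open>r\<close> lies inside the given N. By
  \<open>fq_nbhd_of_passing_near\<close> every point of the former has a \<open>fq_nbhd\<close>
  inside the latter.\<close>

lemma openin_near_interior: "openin (fq_topology X p \<alpha>) (near_interior q n C)"
  unfolding openin_fq_topology[OF choice] fq_open_def
proof (intro conjI ballI)
  show "near_interior q n C \<subseteq> \<Delta>" by (auto simp: near_interior_def)
  fix \<zeta> assume "\<zeta> \<in> near_interior q n C"
  then obtain r where \<zeta>: "\<zeta> \<in> \<Delta>" and r: "1 \<le> r" "fq_nbhd X p \<alpha> \<zeta> r \<subseteq> passing_near X p q n C"
    by (auto simp: near_interior_def)
  have r5: "1 \<le> 5 * r + 5" using r(1) by simp
  obtain C0 where C0: "\<And>R. 0 \<le> R \<Longrightarrow> \<exists>s\<ge>1. fq_nbhd X p \<alpha> \<zeta> s \<subseteq> passing_near X p (\<alpha> \<zeta> R) (5 * r + 5) C0"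
    by (rule fq_nbhd_subset_passing_near[OF \<zeta> r5]) (rule that, blast)
  obtain R where R: "0 \<le> R" "passing_near X p (\<alpha> \<zeta> R) r C0 \<subseteq> fq_nbhd X p \<alpha> \<zeta> r"
    using passing_near_subset_fq_nbhd[OF \<zeta> r(1)] .
  obtain s where s: "1 \<le> s" "fq_nbhd X p \<alpha> \<zeta> s \<subseteq> passing_near X p (\<alpha> \<zeta> R) (5 * r + 5) C0"
    using C0[OF R(1)] by blast
  have "\<theta> \<in> near_interior q n C" if \<theta>: "\<theta> \<in> fq_nbhd X p \<alpha> \<zeta> s" for \<theta>
  proof -
    obtain r' where "1 \<le> r'" "fq_nbhd X p \<alpha> \<theta> r' \<subseteq> passing_near X p (\<alpha> \<zeta> R) r C0"
      using fq_nbhd_of_passing_near[OF subsetD[OF s(2) \<theta>] r(1) chosen_dist(1)[OF \<zeta> R(1) R(1)]] .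
    moreover have "\<theta> \<in> \<Delta>" using \<theta> by (simp add: fq_nbhd_def)
    ultimately show ?thesis using R(2) r(2) unfolding near_interior_def by blast
  qed
  then show "\<exists>s\<ge>1. fq_nbhd X p \<alpha> \<zeta> s \<subseteq> near_interior q n C" using s(1) by blast
qed

text \<open>The choices are made in the order \<open>n\<close>, \<open>c\<close>, \<open>R\<close>,
  \<open>q\<close>; since \<open>C0\<close> does not depend on \<open>R\<close>, the point on
  \<open>\<alpha> \<zeta>\<close> can be taken as far out as \<open>c\<close> demands.\<close>

lemma second_countable_fq:
  assumes Q: "countable Q" "Q \<subseteq> mspace X" "\<And>x. x \<in> mspace X \<Longrightarrow> \<exists>q\<in>Q. mdist X x q \<le> 1"
  shows "second_countable (fq_topology X p \<alpha>)"
  unfolding second_countable_def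
proof (intro exI conjI ballI allI impI)
  let ?B = "(\<lambda>(q, n, c). near_interior q (real n) (real c)) ` (Q \<times> (UNIV :: nat set) \<times> (UNIV :: nat set))"
  show "countable ?B" using Q(1) by (intro countable_image countable_SIGMA) auto
  show "openin (fq_topology X p \<alpha>) V" if "V \<in> ?B" for V using that openin_near_interior by auto
  fix U \<zeta> assume "openin (fq_topology X p \<alpha>) U \<and> \<zeta> \<in> U"
  then obtain r where \<zeta>: "\<zeta> \<in> \<Delta>" and r: "1 \<le> r" "fq_nbhd X p \<alpha> \<zeta> r \<subseteq> U"
    unfolding openin_fq_topology[OF choice] fq_open_def by blast
  obtain n :: nat where n: "r \<le> n" using real_arch_simple by blast
  then have n1: "1 \<le> real n" using r by linarith
  obtain C0 where C0: "\<And>C R. C0 \<le> C \<Longrightarrow> 0 \<le> R \<Longrightarrow> \<exists>s\<ge>1. fq_nbhd X p \<alpha> \<zeta> s \<subseteq> passing_near X p (\<alpha> \<zeta> R) n C"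
    by (rule fq_nbhd_subset_passing_near[OF \<zeta> n1]) (rule that)
  obtain c :: nat where c: "C0 \<le> c" using real_arch_simple by blast
  \<comment> \<open>Moving the centre from \<open>\<alpha> \<zeta> R\<close> to \<open>q\<close> and
    back costs 1 each time, hence \<open>c + 2\<close>.\<close>
  obtain R where R: "0 \<le> R" "passing_near X p (\<alpha> \<zeta> R) n (real c + 2) \<subseteq> fq_nbhd X p \<alpha> \<zeta> n"
    using passing_near_subset_fq_nbhd[OF \<zeta> n1] .
  have \<alpha>R: "\<alpha> \<zeta> R \<in> mspace X" using chosen_dist(1)[OF \<zeta> R(1) R(1)] .
  obtain q where q: "q \<in> Q" "mdist X (\<alpha> \<zeta> R) q \<le> 1" using Q(3)[OF \<alpha>R] by blast
  have qM: "q \<in> mspace X" using q Q(2) by blast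
  obtain s where s: "1 \<le> s" "fq_nbhd X p \<alpha> \<zeta> s \<subseteq> passing_near X p (\<alpha> \<zeta> R) n c" using C0[OF c R(1)] by blast
  have "passing_near X p (\<alpha> \<zeta> R) n c \<subseteq> passing_near X p q n (real c + 1)"
    using passing_near_shift[OF \<alpha>R qM q(2)] .
  then have "fq_nbhd X p \<alpha> \<zeta> s \<subseteq> passing_near X p q n (real c + 1)" using s(2) by blast
  also have c1: "real c + 1 = real (c + 1)" by simp
  finally have "\<zeta> \<in> near_interior q n (real (c + 1))" using s(1) \<zeta> unfolding near_interior_def by blast
  moreover have "passing_near X p q n (real c + 1) \<subseteq> passing_near X p (\<alpha> \<zeta> R) n (real c + 1 + 1)"
    using q(2) by (intro passing_near_shift[OF qM \<alpha>R]) (simp add: mdist_commute)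
  then have "passing_near X p q n (real (c + 1)) \<subseteq> passing_near X p (\<alpha> \<zeta> R) n (real c + 2)"
    by (simp add: add.commute)
  then have "near_interior q n (real (c + 1)) \<subseteq> U"
    using near_interior_subset[of q n "real (c + 1)"] R(2) fq_nbhd_antimono[OF choice \<zeta> _ n] r by force
  ultimately show "\<exists>V\<in>?B. \<zeta> \<in> V \<and> V \<subseteq> U"
    using q(1) by (intro bexI[of _ "near_interior q n (real (c + 1))"] conjI image_eqI[of _ _ "(q, n, c + 1)"]) auto
qed

end

section \<open>Cayley graphs\<close>

lemma graph_dist_le:
  assumes "graph_path V E x l y"
  shows "graph_dist V E x y \<le> l"
  using graph_path_points[OF assms] assms unfolding graph_dist_def
  by (auto intro!: cInf_lower bdd_belowI[of _ 0] dest: graph_path_nonneg)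

text \<open>Unit speed along each edge segment, glued by induction. Asking for paths between
  parameters, instead of an estimate for \<open>graph_dist\<close>, lets the pieces be joined by
  \<open>graph_path_trans\<close>.\<close>

lemma graph_path_parametrization:
  assumes "graph_path V E x l y"
  shows "\<exists>\<sigma>. \<sigma> 0 = x \<and> \<sigma> l = y \<and> (\<forall>r r'. 0 \<le> r \<longrightarrow> r \<le> r' \<longrightarrow> r' \<le> l \<longrightarrow> graph_path V E (\<sigma> r) (r' - r) (\<sigma> r'))"
  using assms
proof (induction rule: graph_path.induct)
  case (refl x)
  have "graph_path V E x (r' - r) x" if "0 \<le> r" "r \<le> r'" "r' \<le> 0" for r r' :: real
  proof -
    have "r' - r = 0" using that by linarith
    then show ?thesis using graph_path.refl[OF refl] by simp
  qed
  then show ?case by (intro exI[of _ "\<lambda>_. x"]) auto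
next
  case (step u v s t l y)
  \<comment> \<open>\<open>sgn (t - s)\<close> is the direction of travel along the edge; for
    \<open>s = t\<close> both it and \<open>?c\<close> vanish.\<close>
  let ?c = "\<bar>s - t\<bar>" and ?z = "\<lambda>r. s + sgn (t - s) * r"
  obtain \<tau> where \<tau>: "\<tau> 0 = edge_point u v t" "\<tau> l = y"
    "\<And>r r'. 0 \<le> r \<Longrightarrow> r \<le> r' \<Longrightarrow> r' \<le> l \<Longrightarrow> graph_path V E (\<tau> r) (r' - r) (\<tau> r')"
    using step.IH by blast
  have l: "0 \<le> l" using graph_path_nonneg[OF step.hyps(6)] .
  define \<sigma> where "\<sigma> = (\<lambda>r. if r \<le> ?c then edge_point u v (?z r) else \<tau> (r - ?c))"
  have zc: "?z ?c = t" by (auto simp: sgn_if)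
  have z01: "0 \<le> ?z r" "?z r \<le> 1" if "0 \<le> r" "r \<le> ?c" for r
    using that step.hyps(2-5) by (auto simp: sgn_if abs_if split: if_splits)
  have seg: "graph_path V E (\<sigma> r) (r' - r) (\<sigma> r')" if "0 \<le> r" "r \<le> r'" "r' \<le> ?c" for r r'
  proof -
    have "\<bar>?z r - ?z r'\<bar> = r' - r" using that by (auto simp: sgn_if abs_if split: if_splits)
    then show ?thesis
      using graph_path_segment[of E u v "?z r" "?z r'" V] step.hyps(1) z01[of r] z01[of r'] that by (simp add: \<sigma>_def)
  qed
  \<comment> \<open>At \<open>r = ?c\<close> the definition of \<open>\<sigma>\<close> selects the
    edge, so agreement with \<open>\<tau>\<close> at the joint has to be checked.\<close>
  have tail: "\<sigma> r = \<tau> (r - ?c)" if "?c \<le> r" for r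
  proof (cases "r = ?c")
    case True
    have "\<sigma> ?c = edge_point u v (?z ?c)" by (simp add: \<sigma>_def)
    then show ?thesis unfolding True zc using \<tau>(1) by simp
  qed (use that in \<open>simp add: \<sigma>_def\<close>)
  have tail_path: "graph_path V E (\<sigma> r) (r' - r) (\<sigma> r')" if "?c \<le> r" "r \<le> r'" "r' \<le> ?c + l" for r r'
    using \<tau>(3)[of "r - ?c" "r' - ?c"] tail[of r] tail[of r'] that by simp
  have "graph_path V E (\<sigma> r) (r' - r) (\<sigma> r')" if r: "0 \<le> r" "r \<le> r'" "r' \<le> ?c + l" for r r'
  proof -
    consider "r' \<le> ?c" | "?c \<le> r" | "r \<le> ?c" "?c \<le> r'" by linarith
    then show ?thesis
    proof cases
      case 3
      show ?thesis
        using graph_path_trans[OF seg[OF r(1) 3(1) order_refl] tail_path[OF order_refl 3(2) r(3)]] by simp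
    qed (use seg tail_path r in auto)
  qed
  moreover have "\<sigma> 0 = edge_point u v s" by (simp add: \<sigma>_def)
  moreover have "\<sigma> (?c + l) = y" using tail[of "?c + l"] l \<tau>(2) by simp
  ultimately show ?case by blast
qed

section \<open>Words in the generators, countability and connectedness\<close>

lemma generate_subset_foldr:
  assumes "group G" "S \<subseteq> carrier G"
  shows "generate G S \<subseteq> (\<lambda>ws. foldr (\<otimes>\<^bsub>G\<^esub>) ws \<one>\<^bsub>G\<^esub>) ` lists (S \<union> m_inv G ` S)"
proof
  interpret group G by fact
  let ?T = "S \<union> m_inv G ` S" and ?f = "\<lambda>ws. foldr (\<otimes>\<^bsub>G\<^esub>) ws \<one>\<^bsub>G\<^esub>"
  have T: "?T \<subseteq> carrier G" using assms(2) by auto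
  have f: "?f ws \<in> carrier G" if "ws \<in> lists ?T" for ws
    using that T by (induction ws) auto
  have app: "?f (ws @ vs) = ?f ws \<otimes>\<^bsub>G\<^esub> ?f vs" if "ws \<in> lists ?T" "vs \<in> lists ?T" for ws vs
    using that(1)
  proof (induction rule: lists.induct)
    case Nil
    then show ?case using f[OF that(2)] by simp
  next
    case (Cons w ws)
    then have "w \<in> carrier G" using T by blast
    then show ?case using Cons f[OF Cons.hyps(2)] f[OF that(2)] by (simp add: m_assoc)
  qed
  fix h assume "h \<in> generate G S"
  then show "h \<in> ?f ` lists ?T"
  proof (induction rule: generate.induct)
    case one
    then show ?case by (intro image_eqI[of _ _ "[]"]) auto
  next
    case (incl h)
    then show ?case using assms(2) by (intro image_eqI[of _ _ "[h]"]) auto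
  next
    case (inv h)
    then show ?case using assms(2) by (intro image_eqI[of _ _ "[inv\<^bsub>G\<^esub> h]"]) auto
  next
    case (eng h1 h2)
    then obtain ws vs where "ws \<in> lists ?T" "vs \<in> lists ?T" "h1 = ?f ws" "h2 = ?f vs" by blast
    then show ?case using app by (intro image_eqI[of _ _ "ws @ vs"]) auto
  qed
qed

lemma countable_generate:
  assumes "group G" "S \<subseteq> carrier G" "countable S"
  shows "countable (generate G S)"
  using generate_subset_foldr[OF assms(1,2)] assms(3)
  by (meson countable_Un countable_image countable_lists countable_subset)

text \<open>Connectedness makes the infimum in \<open>graph_dist\<close> range over a nonempty set.
  Vertices are joined by reading a word letter by letter, and an edge point first moves to an end of
  its edge.\<close>

lemma cayley_graph_connected:
  assumes "group G" "S \<subseteq> carrier G" "generate G S = carrier G"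
    and "x \<in> graph_points (carrier G) (cayley_adj G S)" "y \<in> graph_points (carrier G) (cayley_adj G S)"
  shows "\<exists>l. graph_path (carrier G) (cayley_adj G S) x l y"
proof -
  interpret group G by fact
  let ?path = "graph_path (carrier G) (cayley_adj G S)" and ?T = "S \<union> m_inv G ` S"
  have refl: "?path (vertex_point g) 0 (vertex_point g)" if "g \<in> carrier G" for g
    using that by (intro graph_path.refl) (auto simp: graph_points_def)
  have edge: "\<exists>l. ?path (vertex_point a) l (vertex_point (a \<otimes>\<^bsub>G\<^esub> w))" if a: "a \<in> carrier G" and w: "w \<in> ?T" for a w
  proof (cases "a = a \<otimes>\<^bsub>G\<^esub> w")
    \<comment> \<open>A letter equal to the identity gives no edge, since \<open>cayley_adj\<close>
      excludes loops.\<close>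
    case True
    then show ?thesis using refl[OF a] by auto
  next
    case False
    have wG: "w \<in> carrier G" using w assms(2) by auto
    have "inv\<^bsub>G\<^esub> a \<otimes>\<^bsub>G\<^esub> (a \<otimes>\<^bsub>G\<^esub> w) = w" "inv\<^bsub>G\<^esub> (a \<otimes>\<^bsub>G\<^esub> w) \<otimes>\<^bsub>G\<^esub> a = inv\<^bsub>G\<^esub> w"
      using a wG by (simp_all add: m_assoc[symmetric] inv_mult_group) (simp add: m_assoc)
    moreover have "w \<in> S \<or> inv\<^bsub>G\<^esub> w \<in> S" using w assms(2) by auto
    ultimately have "cayley_adj G S a (a \<otimes>\<^bsub>G\<^esub> w)" using a wG False by (simp add: cayley_adj_def)
    from graph_path_segment[of "cayley_adj G S", OF this, of 0 1] show ?thesis by auto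
  qed
  have word: "\<exists>l. ?path (vertex_point a) l (vertex_point (a \<otimes>\<^bsub>G\<^esub> foldr (\<otimes>\<^bsub>G\<^esub>) ws \<one>\<^bsub>G\<^esub>))"
    if "ws \<in> lists ?T" "a \<in> carrier G" for ws a
    using that
  proof (induction arbitrary: a rule: lists.induct)
    case Nil
    then show ?case using refl by auto
  next
    case (Cons w ws)
    have T: "?T \<subseteq> carrier G" using assms(2) by auto
    then have "w \<in> carrier G" using Cons.hyps(1) by blast
    moreover have "foldr (\<otimes>\<^bsub>G\<^esub>) ws \<one>\<^bsub>G\<^esub> \<in> carrier G"
      using Cons.hyps(2) T by (induction ws) auto
    ultimately show ?case
      using edge[OF Cons.prems Cons.hyps(1)] Cons.IH[of "a \<otimes>\<^bsub>G\<^esub> w"] Cons.prems graph_path_trans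
      by (simp add: m_assoc) blast
  qed
  have vertices: "\<exists>l. ?path (vertex_point a) l (vertex_point b)" if ab: "a \<in> carrier G" "b \<in> carrier G" for a b
  proof -
    have "inv\<^bsub>G\<^esub> a \<otimes>\<^bsub>G\<^esub> b \<in> generate G S" using assms(3) ab by simp
    then obtain ws where ws: "ws \<in> lists ?T" "inv\<^bsub>G\<^esub> a \<otimes>\<^bsub>G\<^esub> b = foldr (\<otimes>\<^bsub>G\<^esub>) ws \<one>\<^bsub>G\<^esub>"
      using generate_subset_foldr[OF assms(1,2)] by blast
    have "a \<otimes>\<^bsub>G\<^esub> (inv\<^bsub>G\<^esub> a \<otimes>\<^bsub>G\<^esub> b) = b" using ab by (simp add: m_assoc[symmetric])
    with word[OF ws(1) ab(1)] ws(2) show ?thesis by simp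
  qed
  have near: "\<exists>l. \<exists>a\<in>carrier G. ?path z l (vertex_point a)"
    if "z \<in> graph_points (carrier G) (cayley_adj G S)" for z
  proof -
    from that consider a where "a \<in> carrier G" "z = vertex_point a"
      | u v t where "cayley_adj G S u v" "0 \<le> t" "t \<le> 1" "z = edge_point u v t"
      by (auto simp: graph_points_def)
    then show ?thesis
    proof cases
      case 1
      then show ?thesis using refl by blast
    next
      case 2
      then have "u \<in> carrier G" by (simp add: cayley_adj_def)
      moreover have "?path z \<bar>t - 0\<bar> (vertex_point u)"
        using graph_path_segment[of "cayley_adj G S" u v t 0] 2 by simp
      ultimately show ?thesis by blast
    qed
  qed
  obtain k a m b where "a \<in> carrier G" "?path x k (vertex_point a)" "b \<in> carrier G" "?path y m (vertex_point b)"
    using near[OF assms(4)] near[OF assms(5)] by blast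
  moreover from this obtain l where "?path (vertex_point a) l (vertex_point b)" using vertices by blast
  ultimately show ?thesis by (meson graph_path_sym graph_path_trans)
qed

text \<open>A path shorter than the infimum plus \<open>e\<close> is parametrized by arc length; its
  subpaths bound \<open>graph_dist\<close> between parameters by the elapsed time.\<close>

lemma length_space_cayley:
  assumes "group G" "S \<subseteq> carrier G" "generate G S = carrier G"
  shows "length_space (cayley_graph G S)"
proof -
  let ?V = "carrier G" and ?E = "cayley_adj G S"
  interpret M: Metric_space "graph_points ?V ?E" "graph_dist ?V ?E" using Metric_space_cayley[OF assms] .
  show ?thesis
    unfolding length_space_def mspace_cayley_graph[OF assms] mdist_cayley_graph[OF assms]
  proof (intro ballI allI impI)
    fix x y and e :: real
    assume xy: "x \<in> graph_points ?V ?E" "y \<in> graph_points ?V ?E" and e: "0 < e"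
    have d: "graph_dist ?V ?E x y = Inf {l. graph_path ?V ?E x l y}" using xy by (simp add: graph_dist_def)
    have "{l. graph_path ?V ?E x l y} \<noteq> {}"
      using cayley_graph_connected[OF assms xy] by auto
    then obtain l where l: "graph_path ?V ?E x l y" "l < graph_dist ?V ?E x y + e"
      using cInf_lessD[of "{l. graph_path ?V ?E x l y}" "graph_dist ?V ?E x y + e"] e d by auto
    obtain \<sigma> where \<sigma>: "\<sigma> 0 = x" "\<sigma> l = y"
      "\<And>r r'. 0 \<le> r \<Longrightarrow> r \<le> r' \<Longrightarrow> r' \<le> l \<Longrightarrow> graph_path ?V ?E (\<sigma> r) (r' - r) (\<sigma> r')"
      using graph_path_parametrization[OF l(1)] by blast
    have "graph_dist ?V ?E (\<sigma> s) (\<sigma> t) \<le> \<bar>s - t\<bar>" if "s \<in> {0..l}" "t \<in> {0..l}" for s t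
      using graph_dist_le[OF \<sigma>(3)[of s t]] graph_dist_le[OF \<sigma>(3)[of t s]] that
      by (cases "s \<le> t") (auto simp: M.commute)
    moreover have "\<sigma> \<in> {0..l} \<rightarrow> graph_points ?V ?E" using graph_path_points[OF \<sigma>(3)] by fastforce
    ultimately show "\<exists>l \<sigma>. 0 \<le> l \<and> l \<le> graph_dist ?V ?E x y + e \<and> \<sigma> \<in> {0..l} \<rightarrow> graph_points ?V ?E \<and>
        \<sigma> 0 = x \<and> \<sigma> l = y \<and> (\<forall>s\<in>{0..l}. \<forall>t\<in>{0..l}. graph_dist ?V ?E (\<sigma> s) (\<sigma> t) \<le> \<bar>s - t\<bar>)"
      using \<sigma>(1,2) l graph_path_nonneg[OF l(1)] by (intro exI[of _ l] exI[of _ \<sigma>]) auto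
  qed
qed

theorem proposition8p5:
  fixes G :: "('a, 'b) monoid_scheme"
    and S :: "'a set"
    and \<alpha> :: "(real \<Rightarrow> 'a \<Rightarrow> real) set \<Rightarrow> real \<Rightarrow> 'a \<Rightarrow> real"
  assumes "group G"
    and "finite S" "S \<subseteq> carrier G" "generate G S = carrier G"
    and "contracting_boundary (cayley_graph G S) (vertex_point \<one>\<^bsub>G\<^esub>) \<noteq> {}"
    and "geodesic_choice (cayley_graph G S) (vertex_point \<one>\<^bsub>G\<^esub>) \<alpha>"
  shows "second_countable (fq_topology (cayley_graph G S) (vertex_point \<one>\<^bsub>G\<^esub>) \<alpha>)"
proof -
  interpret fq_space "cayley_graph G S" "vertex_point \<one>\<^bsub>G\<^esub>" \<alpha>
    using length_space_cayley[OF assms(1,3,4)] assms(6) by unfold_locales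
  let ?V = "carrier G" and ?E = "cayley_adj G S"
  note space = mspace_cayley_graph[OF assms(1,3,4)] mdist_cayley_graph[OF assms(1,3,4)]
  show ?thesis
  proof (rule second_countable_fq)
    \<comment> \<open>The vertices serve as the countable coarsely dense set: every point of an edge
      is within 1 of an end of it.\<close>
    show "countable (vertex_point ` ?V)"
      using countable_generate[OF assms(1,3) countable_finite[OF assms(2)]] assms(4) by simp
    show "vertex_point ` ?V \<subseteq> mspace (cayley_graph G S)" by (auto simp: space graph_points_def)
    fix x assume "x \<in> mspace (cayley_graph G S)"
    then have x: "x \<in> graph_points ?V ?E" by (simp add: space)
    then consider g where "g \<in> ?V" "x = vertex_point g"
      | u v t where "?E u v" "0 \<le> t" "t \<le> 1" "x = edge_point u v t"
      by (auto simp: graph_points_def)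
    then show "\<exists>q\<in>vertex_point ` ?V. mdist (cayley_graph G S) x q \<le> 1"
    proof cases
      case 1
      then have "graph_dist ?V ?E x x \<le> 0" using graph_dist_le[OF graph_path.refl[OF x]] by simp
      then have "graph_dist ?V ?E x x \<le> 1" by simp
      with 1 show ?thesis by (auto simp: space)
    next
      case 2
      then have "graph_dist ?V ?E x (vertex_point u) \<le> t"
        using graph_dist_le[OF graph_path_segment[of ?E u v t 0 ?V]] by simp
      moreover have "u \<in> ?V" using 2(1) by (simp add: cayley_adj_def)
      ultimately show ?thesis using 2(3) by (intro bexI[of _ "vertex_point u"]) (auto simp: space)
    qed
  qed
qed

end
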